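(* The function $F$ on $\mathcal{M}_t$, $$F(S,Q,V,a,b)=\tfrac12\bigl\|S\circ S-Q\,T_{ab}\,(D(\Lambda)+V)\,T_{ab}^{-1}\,Q^{\mathrm T}\bigr\|_F^2,$$ is lower level bounded, i.e. for every $c\in\mathbb{R}$ the level set $$\mathrm{lev}_cF=\{x=(S,Q,V,a,b)\in\mathcal{M}_t: F(x)\le c\}$$ is bounded; in particular the components of $a\in\mathbb{R}_{>0}^t$ are bounded away from zero on each level set. Moreover, $\inf_{\mathcal{M}_t}F$ is attained and the set of minimizers of $F$ over $\mathcal{M}_t$ is compact.
   Context: Let $\Lambda=(\lambda_1,\dots,\lambda_n)^{\mathrm T}$ with $\lambda_1,\dots,\lambda_s\in\mathbb{R}$, $\lambda_{s+1},\dots,\lambda_n\in\mathbb{C}\setminus\mathbb{R}$, $\lambda_{s+2j}=\overline{\lambda_{s+2j-1}}$ for $j=1,\dots,t$, $t=(n-s)/2$. $D(\Lambda)=\mathrm{blockdiag}(\lambda_1,\dots,\lambda_s,\lambda_1^{[2]},\dots,\lambda_t^{[2]})$ with $\lambda_j^{[2]}=\begin{pmatrix}\mathrm{Re}(\lambda_{s+2j-1}) & \mathrm{Im}(\lambda_{s+2j-1})\\ -\mathrm{Im}(\lambda_{s+2j-1}) & \mathrm{Re}(\lambda_{s+2j-1})\end{pmatrix}$. $\mathcal{V}_t$ is the linear space of real upper triangular $n\times n$ matrices $V=(v_{ij})$ with zero diagonal and $v_{s+2j-1,s+2j}=0$ for $j=1,\dots,t$. $\mathcal{OB}(n)$ is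 the set of $S\in\mathbb{R}^{n,n}$ all of whose rows have Euclidean norm $1$. $\mathrm{O}(n)$ is the set of orthogonal $n\times n$ matrices. For $a=(a_1,\dots,a_t)\in\mathbb{R}_{>0}^t$, $b=(b_1,\dots,b_t)\in\mathbb{R}^t$, $T_{ab}=\mathrm{blockdiag}(I_s,T_{a_1b_1},\dots,T_{a_tb_t})$ with $T_{\alpha\beta}=\begin{pmatrix}\alpha&\beta\\0&1/\alpha\end{pmatrix}$. $\circ$ is the componentwise product, $\|\cdot\|_F$ the Frobenius norm, and $$\mathcal{M}_t=\mathcal{OB}(n)\times\mathrm{O}(n)\times\mathcal{V}_t\times\mathbb{R}_{>0}^t\times\mathbb{R}^t.$$ Boundedness of subsets of $\mathcal{M}_t$ is meant with respect to the geodesic distance, where $\mathbb{R}_{>0}^t$ carries the metric $\langle\xi^{(1)},\xi^{(2)}\rangle_a=\sum_k\xi^{(1)}_k\xi^{(2)}_k/a_k^2$, whose geodesic distance is $\|\log a-\log\tilde a\|_2$ (componentwise logarithm), and all other factors carry the Euclidean metric; since $\mathcal{OB}(n)$ and $\mathrm{O}(n)$ are compact, a subset of $\mathcal{M}_t$ is bounded if and only if its $V$-, $b$- and $\log a$-components are bounded in the Euclidean sense. *)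

theory Defs
  imports
    "HOL-Analysis.L2_Norm"
    "HOL-Analysis.Abstract_Metric_Spaces"
    "Jordan_Normal_Form.Gauss_Jordan_Elimination"
    "Jordan_Normal_Form.Determinant"
begin

text \<open>Vectors and matrices are indexed from 0 here, so the entries \<open>s + 2j - 1\<close> and \<open>s + 2j\<close>
  (for \<open>j = 1, ..., t\<close>) of the usual numbering are the entries \<open>s + 2j\<close> and \<open>s + 2j + 1\<close>
  (for \<open>j < t\<close>).\<close>

definition spectrum_vec :: "nat \<Rightarrow> nat \<Rightarrow> nat \<Rightarrow> complex vec \<Rightarrow> bool" where
  "spectrum_vec n s t \<Lambda> \<longleftrightarrow>
     n = s + 2 * t \<and> \<Lambda> \<in> carrier_vec n \<and>
     (\<forall>i<s. \<Lambda> $ i \<in> \<real>) \<and>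
     (\<forall>i. s \<le> i \<and> i < n \<longrightarrow> \<Lambda> $ i \<notin> \<real>) \<and>
     (\<forall>j<t. \<Lambda> $ (s + 2 * j + 1) = cnj (\<Lambda> $ (s + 2 * j)))"

definition block2 :: "complex \<Rightarrow> real mat" where
  "block2 z = mat_of_rows_list 2 [[Re z, Im z], [- Im z, Re z]]"

definition D_mat :: "nat \<Rightarrow> nat \<Rightarrow> complex vec \<Rightarrow> real mat" where
  "D_mat s t \<Lambda> = diag_block_mat
     (map (\<lambda>i. mat_of_rows_list 1 [[Re (\<Lambda> $ i)]]) [0..<s] @
      map (\<lambda>j. block2 (\<Lambda> $ (s + 2 * j))) [0..<t])"

definition T2 :: "real \<Rightarrow> real \<Rightarrow> real mat" where
  "T2 \<alpha> \<beta> = mat_of_rows_list 2 [[\<alpha>, \<beta>], [0, 1 / \<alpha>]]"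

definition T_mat :: "nat \<Rightarrow> nat \<Rightarrow> real vec \<Rightarrow> real vec \<Rightarrow> real mat" where
  "T_mat s t a b = diag_block_mat (1\<^sub>m s # map (\<lambda>k. T2 (a $ k) (b $ k)) [0..<t])"

definition OB :: "nat \<Rightarrow> real mat set" where
  "OB n = {S \<in> carrier_mat n n. \<forall>i<n. L2_set (vec_index (row S i)) {..<n} = 1}"

definition Orth :: "nat \<Rightarrow> real mat set" where
  "Orth n = {Q \<in> carrier_mat n n. transpose_mat Q * Q = 1\<^sub>m n}"

definition V_space :: "nat \<Rightarrow> nat \<Rightarrow> nat \<Rightarrow> real mat set" where
  "V_space n s t = {V \<in> carrier_mat n n.
     upper_triangular V \<and> (\<forall>i<n. V $$ (i, i) = 0) \<and>
     (\<forall>j<t. V $$ (s + 2 * j, s + 2 * j + 1) = 0)}"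

definition pos_vecs :: "nat \<Rightarrow> real vec set" where
  "pos_vecs t = {a \<in> carrier_vec t. \<forall>k<t. a $ k > 0}"

type_synonym point = "real mat \<times> real mat \<times> real mat \<times> real vec \<times> real vec"

definition M_set :: "nat \<Rightarrow> nat \<Rightarrow> nat \<Rightarrow> point set" where
  "M_set n s t = OB n \<times> Orth n \<times> V_space n s t \<times> pos_vecs t \<times> carrier_vec t"

text \<open>The distance on the parameter set. On the positive vectors it is the geodesic distance of the
  metric \<open>\<Sum>k. \<xi> k * \<eta> k / (a k)^2\<close>; on the other factors it is the Euclidean (Frobenius) distance.
  On the two compact factors \<^term>\<open>OB n\<close> and \<^term>\<open>Orth n\<close> the ambient Euclidean distance is used;
  there it induces the usual topology and every subset is bounded,
  so that boundedness only concerns \<open>V\<close>, \<open>log a\<close> and \<open>b\<close>: see \<open>mbounded_M_iff\<close> below.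
  The index ranges are taken from \<open>n\<close> and \<open>t\<close>, not from the arguments, because
  the locale \<^locale>\<open>Metric_space\<close> asks for symmetry on the whole type.\<close>

definition mat_dist :: "nat \<Rightarrow> real mat \<Rightarrow> real mat \<Rightarrow> real" where
  "mat_dist n A B = L2_set (\<lambda>ij. A $$ ij - B $$ ij) ({..<n} \<times> {..<n})"

definition vec_dist :: "nat \<Rightarrow> real vec \<Rightarrow> real vec \<Rightarrow> real" where
  "vec_dist t u v = L2_set (\<lambda>k. u $ k - v $ k) {..<t}"

definition log_dist :: "nat \<Rightarrow> real vec \<Rightarrow> real vec \<Rightarrow> real" where
  "log_dist t u v = L2_set (\<lambda>k. ln (u $ k) - ln (v $ k)) {..<t}"

fun M_dist :: "nat \<Rightarrow> nat \<Rightarrow> point \<Rightarrow> point \<Rightarrow> real" where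
  "M_dist n t (S, Q, V, a, b) (S', Q', V', a', b') =
     sqrt ((mat_dist n S S')\<^sup>2 + (mat_dist n Q Q')\<^sup>2 + (mat_dist n V V')\<^sup>2
           + (log_dist t a a')\<^sup>2 + (vec_dist t b b')\<^sup>2)"

abbreviation M_topology :: "nat \<Rightarrow> nat \<Rightarrow> nat \<Rightarrow> point topology" where
  "M_topology n s t \<equiv> Metric_space.mtopology (M_set n s t) (M_dist n t)"

abbreviation M_bounded :: "nat \<Rightarrow> nat \<Rightarrow> nat \<Rightarrow> point set \<Rightarrow> bool" where
  "M_bounded n s t \<equiv> Metric_space.mbounded (M_set n s t) (M_dist n t)"

definition frob_norm :: "real mat \<Rightarrow> real" where
  "frob_norm A = L2_set (\<lambda>ij. A $$ ij) ({..<dim_row A} \<times> {..<dim_col A})"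

definition hadamard :: "real mat \<Rightarrow> real mat \<Rightarrow> real mat" where
  "hadamard A B = mat (dim_row A) (dim_col A) (\<lambda>ij. A $$ ij * B $$ ij)"

text \<open>Only used for invertible matrices, see \<open>mat_inv_T_mat\<close> below.\<close>

definition mat_inv :: "real mat \<Rightarrow> real mat" where
  "mat_inv A = the (mat_inverse A)"

fun objective :: "nat \<Rightarrow> nat \<Rightarrow> complex vec \<Rightarrow> point \<Rightarrow> real" where
  "objective s t \<Lambda> (S, Q, V, a, b) =
     1 / 2 * (frob_norm (hadamard S S
       - Q * T_mat s t a b * (D_mat s t \<Lambda> + V) * mat_inv (T_mat s t a b) * transpose_mat Q))\<^sup>2"

definition lev :: "nat \<Rightarrow> nat \<Rightarrow> nat \<Rightarrow> complex vec \<Rightarrow> real \<Rightarrow> point set" where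
  "lev n s t \<Lambda> c = {x \<in> M_set n s t. objective s t \<Lambda> x \<le> c}"

definition minimizers :: "nat \<Rightarrow> nat \<Rightarrow> nat \<Rightarrow> complex vec \<Rightarrow> point set" where
  "minimizers n s t \<Lambda> =
     {x \<in> M_set n s t. \<forall>y \<in> M_set n s t. objective s t \<Lambda> x \<le> objective s t \<Lambda> y}"


subsection \<open>The distance is a metric\<close>

lemma L2_set_diff_triangle:
  "L2_set (\<lambda>i. f i - h i) A \<le> L2_set (\<lambda>i. f i - g i) A + L2_set (\<lambda>i. g i - h i) A"
  using L2_set_triangle_ineq[of "\<lambda>i. f i - g i" "\<lambda>i. g i - h i" A] by simp

lemma L2_set_diff_commute: "L2_set (\<lambda>i. f i - g i) A = L2_set (\<lambda>i. g i - f i) A"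
  by (simp add: L2_set_def power2_commute)

lemma mat_dist_triangle: "mat_dist n A C \<le> mat_dist n A B + mat_dist n B C"
  unfolding mat_dist_def by (rule L2_set_diff_triangle)

lemma vec_dist_triangle: "vec_dist n A C \<le> vec_dist n A B + vec_dist n B C"
  unfolding vec_dist_def by (rule L2_set_diff_triangle)

lemma log_dist_triangle: "log_dist n A C \<le> log_dist n A B + log_dist n B C"
  unfolding log_dist_def by (rule L2_set_diff_triangle)

lemma mat_dist_commute: "mat_dist n A B = mat_dist n B A"
  unfolding mat_dist_def by (rule L2_set_diff_commute)

lemma vec_dist_commute: "vec_dist n A B = vec_dist n B A"
  unfolding vec_dist_def by (rule L2_set_diff_commute)

lemma log_dist_commute: "log_dist n A B = log_dist n B A"
  unfolding log_dist_def by (rule L2_set_diff_commute)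

lemma mat_dist_nonneg: "0 \<le> mat_dist n A B"
  and vec_dist_nonneg: "0 \<le> vec_dist t u v"
  and log_dist_nonneg: "0 \<le> log_dist t u v"
  by (simp_all add: mat_dist_def vec_dist_def log_dist_def)

lemma mat_dist_eq_0:
  "A \<in> carrier_mat n n \<Longrightarrow> B \<in> carrier_mat n n \<Longrightarrow> mat_dist n A B = 0 \<longleftrightarrow> A = B"
  by (auto simp: mat_dist_def L2_set_eq_0_iff)

lemma vec_dist_eq_0:
  "u \<in> carrier_vec t \<Longrightarrow> v \<in> carrier_vec t \<Longrightarrow> vec_dist t u v = 0 \<longleftrightarrow> u = v"
  by (auto simp: vec_dist_def L2_set_eq_0_iff)

lemma log_dist_eq_0:
  "u \<in> pos_vecs t \<Longrightarrow> v \<in> pos_vecs t \<Longrightarrow> log_dist t u v = 0 \<longleftrightarrow> u = v"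
  by (auto simp: log_dist_def L2_set_eq_0_iff pos_vecs_def)

lemma sqrt5_triangle:
  fixes x1 x2 x3 x4 x5 :: real
  assumes "0 \<le> x1" "0 \<le> x2" "0 \<le> x3" "0 \<le> x4" "0 \<le> x5"
    and "x1 \<le> y1 + z1" "x2 \<le> y2 + z2" "x3 \<le> y3 + z3" "x4 \<le> y4 + z4" "x5 \<le> y5 + z5"
  shows "sqrt (x1\<^sup>2 + x2\<^sup>2 + x3\<^sup>2 + x4\<^sup>2 + x5\<^sup>2) \<le>
    sqrt (y1\<^sup>2 + y2\<^sup>2 + y3\<^sup>2 + y4\<^sup>2 + y5\<^sup>2) + sqrt (z1\<^sup>2 + z2\<^sup>2 + z3\<^sup>2 + z4\<^sup>2 + z5\<^sup>2)"
proof -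
  have *: "sqrt (u1\<^sup>2 + u2\<^sup>2 + u3\<^sup>2 + u4\<^sup>2 + u5\<^sup>2) = L2_set (\<lambda>i. [u1, u2, u3, u4, u5] ! i) {..<5}"
    for u1 u2 u3 u4 u5 :: real
    by (simp add: L2_set_def eval_nat_numeral lessThan_Suc algebra_simps)
  have "L2_set (\<lambda>i. [x1, x2, x3, x4, x5] ! i) {..<5}
      \<le> L2_set (\<lambda>i. [y1, y2, y3, y4, y5] ! i + [z1, z2, z3, z4, z5] ! i) {..<5}"
  proof (rule L2_set_mono)
    fix i :: nat assume "i \<in> {..<5}"
    then have "i = 0 \<or> i = 1 \<or> i = 2 \<or> i = 3 \<or> i = 4" by auto
    then show "[x1, x2, x3, x4, x5] ! i \<le> [y1, y2, y3, y4, y5] ! i + [z1, z2, z3, z4, z5] ! i"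
      and "0 \<le> [x1, x2, x3, x4, x5] ! i"
      using assms by auto
  qed
  also have "\<dots> \<le> L2_set (\<lambda>i. [y1, y2, y3, y4, y5] ! i) {..<5}
      + L2_set (\<lambda>i. [z1, z2, z3, z4, z5] ! i) {..<5}"
    by (rule L2_set_triangle_ineq)
  finally show ?thesis unfolding * .
qed

lemma Metric_space_M: "Metric_space (M_set n s t) (M_dist n t)"
proof
  fix x y z :: point
  obtain S Q V a b where x: "x = (S, Q, V, a, b)" by (cases x)
  obtain S' Q' V' a' b' where y: "y = (S', Q', V', a', b')" by (cases y)
  obtain S'' Q'' V'' a'' b'' where z: "z = (S'', Q'', V'', a'', b'')" by (cases z)
  show "0 \<le> M_dist n t x y" by (simp add: x y)
  show "M_dist n t x y = M_dist n t y x"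
    by (simp add: x y mat_dist_commute vec_dist_commute log_dist_commute)
  show "M_dist n t x z \<le> M_dist n t x y + M_dist n t y z"
    unfolding x y z M_dist.simps
    by (intro sqrt5_triangle mat_dist_nonneg vec_dist_nonneg log_dist_nonneg
        mat_dist_triangle vec_dist_triangle log_dist_triangle)
  assume "x \<in> M_set n s t" "y \<in> M_set n s t"
  then have mem: "S \<in> carrier_mat n n" "S' \<in> carrier_mat n n" "Q \<in> carrier_mat n n"
    "Q' \<in> carrier_mat n n" "V \<in> carrier_mat n n" "V' \<in> carrier_mat n n"
    "a \<in> pos_vecs t" "a' \<in> pos_vecs t" "b \<in> carrier_vec t" "b' \<in> carrier_vec t"
    by (auto simp: x y M_set_def OB_def Orth_def V_space_def)
  have "M_dist n t x y = 0 \<longleftrightarrow> mat_dist n S S' = 0 \<and> mat_dist n Q Q' = 0 \<and> mat_dist n V V' = 0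
      \<and> log_dist t a a' = 0 \<and> vec_dist t b b' = 0"
    by (simp add: x y add_nonneg_eq_0_iff)
  then show "M_dist n t x y = 0 \<longleftrightarrow> x = y"
    using mem by (simp add: x y mat_dist_eq_0 vec_dist_eq_0 log_dist_eq_0)
qed


subsection \<open>Boundedness in terms of the noncompact components\<close>

lemma OB_bound:
  assumes "S \<in> OB n" "S' \<in> OB n"
  shows "mat_dist n S S' \<le> 2 * sqrt (real n)"
proof -
  have *: "L2_set (\<lambda>ij. A $$ ij) ({..<n} \<times> {..<n}) = sqrt (real n)" if "A \<in> OB n" for A
  proof -
    have A: "A \<in> carrier_mat n n" using that by (simp add: OB_def)
    have row: "(\<Sum>j<n. (A $$ (i, j))\<^sup>2) = 1" if "i < n" for i
    proof -
      have "L2_set (vec_index (row A i)) {..<n} = 1"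
        using \<open>A \<in> OB n\<close> that by (simp add: OB_def)
      then have "(\<Sum>j<n. (row A i $ j)\<^sup>2) = 1" by (simp add: L2_set_def)
      then show ?thesis using A that by simp
    qed
    have "(\<Sum>ij\<in>{..<n} \<times> {..<n}. (A $$ ij)\<^sup>2) = (\<Sum>i<n. \<Sum>j<n. (A $$ (i, j))\<^sup>2)"
      by (simp add: sum.cartesian_product)
    also have "\<dots> = real n" using row by simp
    finally show ?thesis by (simp add: L2_set_def)
  qed
  have "mat_dist n S S' = L2_set (\<lambda>ij. S $$ ij + (- (S' $$ ij))) ({..<n} \<times> {..<n})"
    by (simp add: mat_dist_def)
  also have "\<dots> \<le> L2_set (\<lambda>ij. S $$ ij) ({..<n} \<times> {..<n})
      + L2_set (\<lambda>ij. - (S' $$ ij)) ({..<n} \<times> {..<n})"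
    by (rule L2_set_triangle_ineq)
  also have "L2_set (\<lambda>ij. - (S' $$ ij)) ({..<n} \<times> {..<n})
      = L2_set (\<lambda>ij. S' $$ ij) ({..<n} \<times> {..<n})"
    by (simp add: L2_set_def)
  finally show ?thesis using *[OF assms(1)] *[OF assms(2)] by simp
qed

lemma Orth_subset_OB: "Orth n \<subseteq> OB n"
proof
  fix Q assume "Q \<in> Orth n"
  then have Q: "Q \<in> carrier_mat n n" and 1: "transpose_mat Q * Q = 1\<^sub>m n"
    by (auto simp: Orth_def)
  have "Q * transpose_mat Q = 1\<^sub>m n"
    using mat_mult_left_right_inverse[of "transpose_mat Q" n Q] Q 1 by simp
  then have "(Q * transpose_mat Q) $$ (i, i) = 1" if "i < n" for i using that by simp
  then have "(\<Sum>j<n. (Q $$ (i, j))\<^sup>2) = 1" if "i < n" for i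
    using that Q by (simp add: scalar_prod_def power2_eq_square lessThan_atLeast0)
  then show "Q \<in> OB n" using Q by (auto simp: OB_def L2_set_def)
qed

lemma mbounded_M_iff:
  "M_bounded n s t X \<longleftrightarrow> X \<subseteq> M_set n s t \<and>
     (\<exists>B. \<forall>(S, Q, V, a, b) \<in> X.
        frob_norm V \<le> B \<and> L2_set (vec_index b) {..<t} \<le> B
        \<and> L2_set (\<lambda>k. ln (a $ k)) {..<t} \<le> B)"
    (is "_ \<longleftrightarrow> _ \<and> (\<exists>B. ?P B)")
proof -
  let ?z = "0\<^sub>m n n :: real mat"
  define one :: "real vec" where "one = vec t (\<lambda>_. 1)"
  have fr: "frob_norm V = mat_dist n V ?z" if "V \<in> carrier_mat n n" for V
    using that by (auto simp: frob_norm_def mat_dist_def intro!: L2_set_cong)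
  have bv: "L2_set (vec_index b) {..<t} = vec_dist t b (0\<^sub>v t)" for b :: "real vec"
    by (auto simp: vec_dist_def intro!: L2_set_cong)
  have lv: "L2_set (\<lambda>k. ln (a $ k)) {..<t} = log_dist t a one" for a :: "real vec"
    by (auto simp: log_dist_def one_def intro!: L2_set_cong)
  interpret Metric_space "M_set n s t" "M_dist n t" by (rule Metric_space_M)
  show ?thesis
  proof (intro iffI conjI)
    assume b: "M_bounded n s t X"
    then show sub: "X \<subseteq> M_set n s t" by (rule mbounded_subset_mspace)
    from b obtain C where C: "\<And>x y. x \<in> X \<Longrightarrow> y \<in> X \<Longrightarrow> M_dist n t x y \<le> C"
      unfolding mbounded_alt by blast
    show "\<exists>B. ?P B"
    proof (cases "X = {}")
      case True
      then show ?thesis by simp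
    next
      case False
      then obtain S' Q' V' a' b' where x': "(S', Q', V', a', b') \<in> X" by auto
      let ?B = "C + frob_norm V' + L2_set (vec_index b') {..<t} + L2_set (\<lambda>k. ln (a' $ k)) {..<t}"
      have "?P ?B"
      proof clarify
        fix S Q V a b assume x: "(S, Q, V, a, b) \<in> X"
        let ?sum = "(mat_dist n S S')\<^sup>2 + (mat_dist n Q Q')\<^sup>2 + (mat_dist n V V')\<^sup>2
           + (log_dist t a a')\<^sup>2 + (vec_dist t b b')\<^sup>2"
        have d: "sqrt ?sum \<le> C" using C[OF x x'] by simp
        have "mat_dist n V V' \<le> sqrt ?sum" "log_dist t a a' \<le> sqrt ?sum"
          "vec_dist t b b' \<le> sqrt ?sum"
          by (rule real_le_rsqrt; simp)+
        moreover have "V \<in> carrier_mat n n" "V' \<in> carrier_mat n n"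
          using sub x x' by (auto simp: M_set_def V_space_def)
        moreover have "0 \<le> mat_dist n V' ?z" "0 \<le> vec_dist t b' (0\<^sub>v t)" "0 \<le> log_dist t a' one"
          by (simp_all add: mat_dist_nonneg vec_dist_nonneg log_dist_nonneg)
        ultimately show "frob_norm V \<le> ?B \<and> L2_set (vec_index b) {..<t} \<le> ?B
            \<and> L2_set (\<lambda>k. ln (a $ k)) {..<t} \<le> ?B"
          using d mat_dist_triangle[of n V ?z V'] vec_dist_triangle[of t b "0\<^sub>v t" b']
            log_dist_triangle[of t a one a'] by (simp add: fr bv lv)
      qed
      then show ?thesis by blast
    qed
  next
    assume "X \<subseteq> M_set n s t \<and> (\<exists>B. ?P B)"
    then obtain B where sub: "X \<subseteq> M_set n s t" and B: "?P B" by blast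
    have "M_dist n t x y \<le> sqrt (2 * (2 * sqrt (real n))\<^sup>2 + 3 * (2 * B)\<^sup>2)"
      if "x \<in> X" "y \<in> X" for x y
    proof -
      obtain S Q V a b where x: "x = (S, Q, V, a, b)" by (cases x)
      obtain S' Q' V' a' b' where y: "y = (S', Q', V', a', b')" by (cases y)
      have mem: "V \<in> carrier_mat n n" "V' \<in> carrier_mat n n" "S \<in> OB n" "S' \<in> OB n"
        "Q \<in> OB n" "Q' \<in> OB n"
        using sub that Orth_subset_OB by (auto simp: x y M_set_def V_space_def)
      have "mat_dist n V ?z \<le> B" "log_dist t a one \<le> B" "vec_dist t b (0\<^sub>v t) \<le> B"
        "mat_dist n V' ?z \<le> B" "log_dist t a' one \<le> B" "vec_dist t b' (0\<^sub>v t) \<le> B"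
        using bspec[OF B that(1)] bspec[OF B that(2)] mem by (simp_all add: x y fr bv lv)
      then have "mat_dist n V V' \<le> 2 * B" "log_dist t a a' \<le> 2 * B" "vec_dist t b b' \<le> 2 * B"
        using mat_dist_triangle[of n V V' ?z] vec_dist_triangle[of t b b' "0\<^sub>v t"]
          log_dist_triangle[of t a a' one]
          mat_dist_commute[of n ?z V'] vec_dist_commute[of t "0\<^sub>v t" b']
          log_dist_commute[of t one a']
        by linarith+
      note d = this
      have "(mat_dist n V V')\<^sup>2 \<le> (2 * B)\<^sup>2" "(log_dist t a a')\<^sup>2 \<le> (2 * B)\<^sup>2"
        "(vec_dist t b b')\<^sup>2 \<le> (2 * B)\<^sup>2"
        by (rule power_mono[OF d(1) mat_dist_nonneg] power_mono[OF d(2) log_dist_nonneg]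
            power_mono[OF d(3) vec_dist_nonneg])+
      moreover have "(mat_dist n S S')\<^sup>2 \<le> (2 * sqrt (real n))\<^sup>2"
        "(mat_dist n Q Q')\<^sup>2 \<le> (2 * sqrt (real n))\<^sup>2"
        by (intro power_mono OB_bound mat_dist_nonneg mem)+
      ultimately show ?thesis unfolding x y M_dist.simps by (intro real_sqrt_le_mono) linarith
    qed
    then show "M_bounded n s t X" unfolding mbounded_alt using sub by blast
  qed
qed


subsection \<open>The inverse of the block diagonal transformation\<close>

lemma diag_block_mat_inverse:
  assumes "\<And>k. k \<in> set ks \<Longrightarrow> f k \<in> carrier_mat 2 2 \<and> g k \<in> carrier_mat 2 2 \<and> f k * g k = 1\<^sub>m 2"
  shows "diag_block_mat (map f ks) \<in> carrier_mat (2 * length ks) (2 * length ks)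
    \<and> diag_block_mat (map g ks) \<in> carrier_mat (2 * length ks) (2 * length ks)
    \<and> diag_block_mat (map f ks) * diag_block_mat (map g ks) = (1\<^sub>m (2 * length ks) :: real mat)"
  using assms
proof (induction ks)
  case Nil
  then show ?case by auto
next
  case (Cons k ks)
  let ?m = "2 * length ks"
  let ?F = "diag_block_mat (map f ks)" and ?G = "diag_block_mat (map g ks)"
  have k: "f k \<in> carrier_mat 2 2" "g k \<in> carrier_mat 2 2" "f k * g k = 1\<^sub>m 2"
    using Cons.prems[of k] by auto
  have IH: "?F \<in> carrier_mat ?m ?m" "?G \<in> carrier_mat ?m ?m" "?F * ?G = 1\<^sub>m ?m"
    using Cons.IH Cons.prems by auto
  have F: "diag_block_mat (map f (k # ks)) = four_block_mat (f k) (0\<^sub>m 2 ?m) (0\<^sub>m ?m 2) ?F"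
    and G: "diag_block_mat (map g (k # ks)) = four_block_mat (g k) (0\<^sub>m 2 ?m) (0\<^sub>m ?m 2) ?G"
    using k IH by (auto simp: Let_def)
  have "diag_block_mat (map f (k # ks)) * diag_block_mat (map g (k # ks)) = 1\<^sub>m (2 + ?m)"
    unfolding F G
    using mult_four_block_mat[OF k(1) zero_carrier_mat zero_carrier_mat IH(1)
        k(2) zero_carrier_mat zero_carrier_mat IH(2)] k IH
    by simp
  then show ?case unfolding F G using k IH by (auto intro!: four_block_carrier_mat)
qed

lemma T_mat_carrier [simp]: "T_mat s t a b \<in> carrier_mat (s + 2 * t) (s + 2 * t)"
proof -
  have "dim_row (T2 \<alpha> \<beta>) = 2" "dim_col (T2 \<alpha> \<beta>) = 2" for \<alpha> \<beta>
    by (simp_all add: T2_def mat_of_rows_list_def)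
  then have "map dim_row (map (\<lambda>k. T2 (a $ k) (b $ k)) [0..<t]) = replicate t 2"
    "map dim_col (map (\<lambda>k. T2 (a $ k) (b $ k)) [0..<t]) = replicate t 2"
    by (simp_all add: map_replicate_const comp_def)
  then show ?thesis
    by (intro carrier_matI)
      (simp_all add: T_mat_def dim_diag_block_mat sum_list_replicate del: diag_block_mat.simps map_map)
qed

lemma mat_inv_T_mat:
  assumes "a \<in> pos_vecs t"
  shows "mat_inv (T_mat s t a b) \<in> carrier_mat (s + 2 * t) (s + 2 * t)"
    "T_mat s t a b * mat_inv (T_mat s t a b) = 1\<^sub>m (s + 2 * t)"
    "mat_inv (T_mat s t a b) * T_mat s t a b = 1\<^sub>m (s + 2 * t)"
proof -
  let ?n = "s + 2 * t" and ?T = "T_mat s t a b"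
  define f where "f k = T2 (a $ k) (b $ k)" for k
  define g where "g k = mat_of_rows_list 2 [[1 / a $ k, - b $ k], [0, a $ k]]" for k
  define F G where "F = diag_block_mat (map f [0..<t])" and "G = diag_block_mat (map g [0..<t])"
  have fg: "f k \<in> carrier_mat 2 2 \<and> g k \<in> carrier_mat 2 2 \<and> f k * g k = 1\<^sub>m 2"
    if "k \<in> set [0..<t]" for k
  proof -
    have "a $ k > 0" using assms that by (simp add: pos_vecs_def)
    then have "f k * g k = 1\<^sub>m 2"
      by (intro eq_matI)
        (auto simp: f_def g_def T2_def mat_of_rows_list_def scalar_prod_def less_2_cases_iff)
    then show ?thesis by (auto simp: f_def g_def T2_def mat_of_rows_list_def)
  qed
  have FG: "F \<in> carrier_mat (2 * t) (2 * t)" "G \<in> carrier_mat (2 * t) (2 * t)"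
    "F * G = 1\<^sub>m (2 * t)"
    using diag_block_mat_inverse[of "[0..<t]" f g] fg by (auto simp: F_def G_def)
  define T' where "T' = four_block_mat (1\<^sub>m s) (0\<^sub>m s (2 * t)) (0\<^sub>m (2 * t) s) G"
  have T': "T' \<in> carrier_mat ?n ?n" using FG unfolding T'_def by auto
  have T: "?T = four_block_mat (1\<^sub>m s) (0\<^sub>m s (2 * t)) (0\<^sub>m (2 * t) s) F"
    using FG by (simp add: T_mat_def Let_def F_def[symmetric] f_def[symmetric])
  have TT': "?T * T' = 1\<^sub>m ?n"
    unfolding T T'_def
    using mult_four_block_mat[OF one_carrier_mat zero_carrier_mat zero_carrier_mat FG(1)
        one_carrier_mat zero_carrier_mat zero_carrier_mat FG(2)] FG
    by simp
  have "?T \<in> Units (ring_mat TYPE(real) ?n ())"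
    using mat_mult_left_right_inverse[OF T_mat_carrier T' TT'] TT' T'
    by (auto simp: Units_def ring_mat_simps)
  then obtain B where B: "mat_inverse ?T = Some B"
    using mat_inverse(1)[OF T_mat_carrier, where b = "()"] by (cases "mat_inverse ?T") auto
  from mat_inverse(2)[OF T_mat_carrier B]
  show "mat_inv ?T \<in> carrier_mat ?n ?n" "?T * mat_inv ?T = 1\<^sub>m ?n" "mat_inv ?T * ?T = 1\<^sub>m ?n"
    by (simp_all add: mat_inv_def B)
qed

end

theory Submission
  imports Defs
begin

text \<open>Write \<open>M = T\<^sub>a\<^sub>b (D(\<Lambda>) + V) T\<^sub>a\<^sub>b\<^sup>-\<^sup>1\<close>. On a level set the entries of \<open>S \<circ> S - Q M Q\<^sup>T\<close> are bounded, hence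
  so are those of \<open>M\<close>, because \<open>S\<close> and \<open>Q\<close> are bounded. The diagonal block of \<open>M\<close> belonging to a
  nonreal eigenvalue \<open>\<lambda>\<close> has the off-diagonal entries \<open>Im \<lambda> (a\<^sup>2 + b\<^sup>2)\<close> and \<open>- Im \<lambda> / a\<^sup>2\<close>; as
  \<open>Im \<lambda> \<noteq> 0\<close>, this bounds \<open>a\<close>, \<open>1 / a\<close> and \<open>b\<close>, and then \<open>V = T\<^sub>a\<^sub>b\<^sup>-\<^sup>1 M T\<^sub>a\<^sub>b - D(\<Lambda>)\<close>. So every sequence in
  a level set has an entrywise convergent subsequence, whose limit lies in the parameter set since
  \<open>log a\<close> converges; the level sets are compact, and the minimizers form one of them.\<close>

section \<open>Entries of the block diagonal matrices \<open>T_mat\<close> and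
  \<open>D_mat\<close>\<close>

lemma diag_block_mat_2x2_index:
  fixes f :: "'a \<Rightarrow> 'b :: zero mat"
  assumes "\<And>k. k \<in> set ks \<Longrightarrow> f k \<in> carrier_mat 2 2"
  shows "diag_block_mat (map f ks) \<in> carrier_mat (2 * length ks) (2 * length ks)"
    and "i < 2 * length ks \<Longrightarrow> j < 2 * length ks \<Longrightarrow> diag_block_mat (map f ks) $$ (i, j) =
      (if i div 2 = j div 2 then f (ks ! (i div 2)) $$ (i mod 2, j mod 2) else 0)"
proof -
  have "diag_block_mat (map f ks) \<in> carrier_mat (2 * length ks) (2 * length ks) \<and>
    (\<forall>i j. i < 2 * length ks \<longrightarrow> j < 2 * length ks \<longrightarrow> diag_block_mat (map f ks) $$ (i, j) =
      (if i div 2 = j div 2 then f (ks ! (i div 2)) $$ (i mod 2, j mod 2) else 0))"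
    using assms
  proof (induction ks)
    case Nil
    then show ?case by simp
  next
    case (Cons k ks)
    let ?m = "2 * length ks" and ?G = "diag_block_mat (map f ks)"
    have k: "f k \<in> carrier_mat 2 2" using Cons.prems by simp
    have IH: "?G \<in> carrier_mat ?m ?m"
      "\<And>i j. i < ?m \<Longrightarrow> j < ?m \<Longrightarrow> ?G $$ (i, j) =
        (if i div 2 = j div 2 then f (ks ! (i div 2)) $$ (i mod 2, j mod 2) else 0)"
      using Cons.IH Cons.prems by auto
    have F: "diag_block_mat (map f (k # ks)) = four_block_mat (f k) (0\<^sub>m 2 ?m) (0\<^sub>m ?m 2) ?G"
      using k IH(1) by (auto simp: Let_def)
    have "diag_block_mat (map f (k # ks)) $$ (i, j) =
        (if i div 2 = j div 2 then f ((k # ks) ! (i div 2)) $$ (i mod 2, j mod 2) else 0)"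
      if ij: "i < 2 * length (k # ks)" "j < 2 * length (k # ks)" for i j
    proof -
      have dims: "dim_row (f k) = 2" "dim_col (f k) = 2" "dim_row ?G = ?m" "dim_col ?G = ?m"
        using k IH(1) by auto
      \<comment> \<open>The four cases are the four blocks of \<open>four_block_mat\<close>. In the
        last one both indices are shifted by 2, so both quotients drop by one and the entry is read
        from the tail.\<close>
      consider "i < 2" "j < 2" | j' where "i < 2" "j = j' + 2" | i' where "i = i' + 2" "j < 2"
        | i' j' where "i = i' + 2" "j = j' + 2"
        by (metis add.commute le_Suc_ex not_less)
      then show ?thesis
      proof cases
        case 1
        then show ?thesis unfolding F by (simp add: dims)
      next
        case 2
        then have "j' < ?m" using ij by auto
        then show ?thesis using 2 unfolding F by (simp add: dims)
      next
        case 3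
        then have "i' < ?m" using ij by auto
        then show ?thesis using 3 unfolding F by (simp add: dims)
      next
        case 4
        then have "i' < ?m" "j' < ?m" using ij by auto
        then show ?thesis using 4 IH(2)[of i' j'] unfolding F by (simp add: dims)
      qed
    qed
    then show ?case using k IH(1) unfolding F by (auto intro!: four_block_carrier_mat)
  qed
  then show "diag_block_mat (map f ks) \<in> carrier_mat (2 * length ks) (2 * length ks)"
    and "i < 2 * length ks \<Longrightarrow> j < 2 * length ks \<Longrightarrow> diag_block_mat (map f ks) $$ (i, j) =
      (if i div 2 = j div 2 then f (ks ! (i div 2)) $$ (i mod 2, j mod 2) else 0)"
    by auto
qed

lemma diag_block_mat_2x2_entries:
  fixes f :: "nat \<Rightarrow> 'b :: zero mat"
  assumes "\<And>k. k < t \<Longrightarrow> f k \<in> carrier_mat 2 2" and "k < t"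
  shows "diag_block_mat (map f [0..<t]) $$ (2 * k, 2 * k) = f k $$ (0, 0)"
    "diag_block_mat (map f [0..<t]) $$ (2 * k, Suc (2 * k)) = f k $$ (0, 1)"
    "diag_block_mat (map f [0..<t]) $$ (Suc (2 * k), 2 * k) = f k $$ (1, 0)"
    "diag_block_mat (map f [0..<t]) $$ (Suc (2 * k), Suc (2 * k)) = f k $$ (1, 1)"
  using diag_block_mat_2x2_index(2)[of "[0..<t]" f] assms by auto

lemma T2_carrier [simp]: "T2 \<alpha> \<beta> \<in> carrier_mat 2 2"
  by (auto simp: T2_def mat_of_rows_list_def)

lemma T2_index [simp]:
  "T2 \<alpha> \<beta> $$ (0, 0) = \<alpha>" "T2 \<alpha> \<beta> $$ (0, Suc 0) = \<beta>"
  "T2 \<alpha> \<beta> $$ (Suc 0, 0) = 0" "T2 \<alpha> \<beta> $$ (Suc 0, Suc 0) = 1 / \<alpha>"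
  by (simp_all add: T2_def mat_of_rows_list_def)

text \<open>Rows of \<open>T_mat\<close> come in three shapes: a unit row in the real part, and the
  first or the second row of a 2 x 2 block. Later case distinctions on a row index follow these
  shapes.\<close>

lemma block_index_cases:
  fixes i s t :: nat
  assumes "i < s + 2 * t"
  obtains "i < s" | k where "k < t" "i = s + 2 * k" | k where "k < t" "i = Suc (s + 2 * k)"
proof (cases "i < s")
  case False
  define k where "k = (i - s) div 2"
  have "k < t" using False assms by (auto simp: k_def)
  moreover have "i = s + 2 * k \<or> i = Suc (s + 2 * k)"
    using False unfolding k_def by linarith
  ultimately show thesis using that by blast
qed (rule that)

lemma T_mat_four_block:
  fixes a b :: "real vec"
  shows "diag_block_mat (map (\<lambda>k. T2 (a $ k) (b $ k)) [0..<t]) \<in> carrier_mat (2 * t) (2 * t)"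
    and "T_mat s t a b = four_block_mat (1\<^sub>m s) (0\<^sub>m s (2 * t)) (0\<^sub>m (2 * t) s)
      (diag_block_mat (map (\<lambda>k. T2 (a $ k) (b $ k)) [0..<t]))"
proof -
  show F: "diag_block_mat (map (\<lambda>k. T2 (a $ k) (b $ k)) [0..<t]) \<in> carrier_mat (2 * t) (2 * t)"
    using diag_block_mat_2x2_index(1)[of "[0..<t]" "\<lambda>k. T2 (a $ k) (b $ k)"] by simp
  show "T_mat s t a b = four_block_mat (1\<^sub>m s) (0\<^sub>m s (2 * t)) (0\<^sub>m (2 * t) s)
      (diag_block_mat (map (\<lambda>k. T2 (a $ k) (b $ k)) [0..<t]))"
    using carrier_matD[OF F] unfolding T_mat_def diag_block_mat.simps Let_def by simp
qed

lemma T_mat_index_lt: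
  assumes "i < s + 2 * t" "j < s + 2 * t" "i < s \<or> j < s"
  shows "T_mat s t a b $$ (i, j) = (if i = j then 1 else 0)"
proof -
  define F where "F = diag_block_mat (map (\<lambda>k. T2 (a $ k) (b $ k)) [0..<t])"
  note F = T_mat_four_block(1)[of a b t, folded F_def]
    and T = T_mat_four_block(2)[of s t a b, folded F_def]
  show ?thesis using assms F unfolding T by auto
qed

lemma T_mat_index_ge:
  assumes "i < 2 * t" "j < 2 * t"
  shows "T_mat s t a b $$ (s + i, s + j) =
    (if i div 2 = j div 2 then T2 (a $ (i div 2)) (b $ (i div 2)) $$ (i mod 2, j mod 2) else 0)"
proof -
  define F where "F = diag_block_mat (map (\<lambda>k. T2 (a $ k) (b $ k)) [0..<t])"
  note F = T_mat_four_block(1)[of a b t, folded F_def]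
    and T = T_mat_four_block(2)[of s t a b, folded F_def]
  have "T_mat s t a b $$ (s + i, s + j) = F $$ (i, j)"
    using assms F unfolding T by simp
  moreover have "i div 2 < t" using assms by auto
  ultimately show ?thesis
    using assms diag_block_mat_2x2_index(2)[of "[0..<t]" "\<lambda>k. T2 (a $ k) (b $ k)" i j]
    by (simp add: F_def)
qed

lemma T_mat_block:
  assumes "k < t"
  shows "T_mat s t a b $$ (s + 2 * k, s + 2 * k) = a $ k"
    "T_mat s t a b $$ (s + 2 * k, Suc (s + 2 * k)) = b $ k"
    "T_mat s t a b $$ (Suc (s + 2 * k), Suc (s + 2 * k)) = 1 / a $ k"
  using assms T_mat_index_ge[of "2 * k" t "2 * k"] T_mat_index_ge[of "2 * k" t "Suc (2 * k)"]
    T_mat_index_ge[of "Suc (2 * k)" t "Suc (2 * k)"]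
  by simp_all

text \<open>\<open>T_mat\<close> is upper bidiagonal, and its superdiagonal can be nonzero only in
  the first row of a 2 x 2 block. This reduces products with it to at most two terms per
  entry.\<close>

lemma T_mat_eq_0:
  assumes "i < s + 2 * t" "j < s + 2 * t" "i \<noteq> j"
    and "\<And>k. k < t \<Longrightarrow> i = s + 2 * k \<Longrightarrow> j \<noteq> Suc (s + 2 * k)"
  shows "T_mat s t a b $$ (i, j) = 0"
proof (cases "i < s \<or> j < s")
  case True
  then show ?thesis using assms by (simp add: T_mat_index_lt)
next
  case False
  then obtain i' j' where ij: "i = s + i'" "j = s + j'"
    by (metis le_Suc_ex not_less)
  have *: "i' = 2 * k \<Longrightarrow> j' \<noteq> Suc (2 * k)" if "k < t" for k
    using assms(4)[of k] that ij by auto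
  show ?thesis
  proof (cases "i' div 2 = j' div 2")
    case True
    \<comment> \<open>Within one block, off the diagonal and away from the position of
      \<open>b\<close>, only the lower left corner remains, where \<open>T2\<close> is 0.\<close>
    then have "i' mod 2 = 1" "j' mod 2 = 0"
      using *[of "i' div 2"] assms ij
      by (metis (no_types, lifting) add_less_cancel_left div_mult_mod_eq less_mult_imp_div_less
          mod2_eq_if mult.commute plus_1_eq_Suc add.commute add.right_neutral)+
    then show ?thesis using True assms ij by (simp add: T_mat_index_ge)
  qed (use assms ij in \<open>simp add: T_mat_index_ge\<close>)
qed

lemma D_mat_carrier [simp]: "D_mat s t \<Lambda> \<in> carrier_mat (s + 2 * t) (s + 2 * t)"
  and D_mat_block:
    "k < t \<Longrightarrow> D_mat s t \<Lambda> $$ (s + 2 * k, s + 2 * k) = Re (\<Lambda> $ (s + 2 * k))"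
    "k < t \<Longrightarrow> D_mat s t \<Lambda> $$ (s + 2 * k, Suc (s + 2 * k)) = Im (\<Lambda> $ (s + 2 * k))"
    "k < t \<Longrightarrow> D_mat s t \<Lambda> $$ (Suc (s + 2 * k), s + 2 * k) = - Im (\<Lambda> $ (s + 2 * k))"
    "k < t \<Longrightarrow> D_mat s t \<Lambda> $$ (Suc (s + 2 * k), Suc (s + 2 * k)) = Re (\<Lambda> $ (s + 2 * k))"
proof -
  define E where "E = diag_block_mat (map (\<lambda>i. mat_of_rows_list 1 [[Re (\<Lambda> $ i)]]) [0..<s])"
  define f where "f j = block2 (\<Lambda> $ (s + 2 * j))" for j
  define F where "F = diag_block_mat (map f [0..<t])"
  have "map dim_row (map (\<lambda>i. mat_of_rows_list 1 [[Re (\<Lambda> $ i)]]) [0..<s]) = replicate s 1"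
    "map dim_col (map (\<lambda>i. mat_of_rows_list 1 [[Re (\<Lambda> $ i)]]) [0..<s]) = replicate s 1"
    by (simp_all add: map_replicate_const comp_def mat_of_rows_list_def)
  then have E: "E \<in> carrier_mat s s"
    by (intro carrier_matI)
      (simp_all add: E_def dim_diag_block_mat sum_list_replicate del: map_map)
  have f: "f k \<in> carrier_mat 2 2" for k by (auto simp: f_def block2_def mat_of_rows_list_def)
  have F: "F \<in> carrier_mat (2 * t) (2 * t)"
    using diag_block_mat_2x2_index(1)[of "[0..<t]" f] f by (simp add: F_def)
  have D: "D_mat s t \<Lambda> = four_block_mat E (0\<^sub>m s (2 * t)) (0\<^sub>m (2 * t) s) F"
    unfolding D_mat_def diag_block_mat_append Let_def E_def[symmetric] f_def[symmetric]
      F_def[symmetric]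
    using E F by simp
  show "D_mat s t \<Lambda> \<in> carrier_mat (s + 2 * t) (s + 2 * t)"
    using E F by (auto simp: D)
  note ent = diag_block_mat_2x2_entries[of t f, OF f, folded F_def]
  show "k < t \<Longrightarrow> D_mat s t \<Lambda> $$ (s + 2 * k, s + 2 * k) = Re (\<Lambda> $ (s + 2 * k))"
    "k < t \<Longrightarrow> D_mat s t \<Lambda> $$ (s + 2 * k, Suc (s + 2 * k)) = Im (\<Lambda> $ (s + 2 * k))"
    "k < t \<Longrightarrow> D_mat s t \<Lambda> $$ (Suc (s + 2 * k), s + 2 * k) = - Im (\<Lambda> $ (s + 2 * k))"
    "k < t \<Longrightarrow> D_mat s t \<Lambda> $$ (Suc (s + 2 * k), Suc (s + 2 * k)) = Re (\<Lambda> $ (s + 2 * k))"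
    using E F ent by (auto simp: D Suc_diff_le f_def block2_def mat_of_rows_list_def)
qed

section \<open>Products with \<open>T_mat\<close>, and its inverse\<close>

lemma mult_mat_index:
  assumes "A \<in> carrier_mat m n" "B \<in> carrier_mat n l" "i < m" "j < l"
  shows "(A * B) $$ (i, j) = (\<Sum>k<n. A $$ (i, k) * B $$ (k, j))"
  using assms by (simp add: scalar_prod_def lessThan_atLeast0)

text \<open>In row \<open>i\<close> of \<open>T_mat\<close> only columns \<open>i\<close> and
  \<open>Suc i\<close> can be nonzero; the guard drops the second term in the last row.\<close>

lemma T_mat_mult_index:
  assumes "A \<in> carrier_mat (s + 2 * t) m" "i < s + 2 * t" "j < m"
  shows "(T_mat s t a b * A) $$ (i, j) = T_mat s t a b $$ (i, i) * A $$ (i, j) +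
    (if Suc i < s + 2 * t then T_mat s t a b $$ (i, Suc i) * A $$ (Suc i, j) else 0)"
proof -
  have "(T_mat s t a b * A) $$ (i, j) = (\<Sum>k<s + 2 * t. T_mat s t a b $$ (i, k) * A $$ (k, j))"
    by (rule mult_mat_index[OF T_mat_carrier assms])
  also have "\<dots> = (\<Sum>k\<in>{i, Suc i} \<inter> {..<s + 2 * t}. T_mat s t a b $$ (i, k) * A $$ (k, j))"
    using assms by (intro sum.mono_neutral_right) (auto intro!: T_mat_eq_0)
  also have "{i, Suc i} \<inter> {..<s + 2 * t} = (if Suc i < s + 2 * t then {i, Suc i} else {i})"
    using assms by auto
  finally show ?thesis by (simp split: if_splits)
qed

text \<open>In column \<open>j\<close> of \<open>T_mat\<close> only rows \<open>j - 1\<close> and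
  \<open>j\<close> can be nonzero. For \<open>j = 0\<close> truncated subtraction gives
  \<open>j - 1 = 0\<close>, so without the guard the diagonal term would be counted twice.\<close>

lemma mult_T_mat_index:
  assumes "A \<in> carrier_mat m (s + 2 * t)" "i < m" "j < s + 2 * t"
  shows "(A * T_mat s t a b) $$ (i, j) = A $$ (i, j) * T_mat s t a b $$ (j, j) +
    (if 0 < j then A $$ (i, j - 1) * T_mat s t a b $$ (j - 1, j) else 0)"
proof -
  have "(A * T_mat s t a b) $$ (i, j) = (\<Sum>k<s + 2 * t. A $$ (i, k) * T_mat s t a b $$ (k, j))"
    by (rule mult_mat_index[OF assms(1) T_mat_carrier assms(2,3)])
  also have "\<dots> = (\<Sum>k\<in>(if 0 < j then {j, j - 1} else {j}). A $$ (i, k) * T_mat s t a b $$ (k, j))"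
    using assms by (intro sum.mono_neutral_right) (auto intro!: T_mat_eq_0)
  finally show ?thesis by (cases j) simp_all
qed

text \<open>A block with rows (a, b) and (0, 1/a) has determinant 1, so its inverse has rows (1/a,
  -b) and (0, a). The inverse is thus again a \<open>T_mat\<close>, and entry formulas, bounds and
  limits for \<open>T_mat\<close> apply to it.\<close>

lemma mat_inv_T_mat_eq:
  assumes a: "a \<in> pos_vecs t" and b: "b \<in> carrier_vec t"
  shows "mat_inv (T_mat s t a b) = T_mat s t (vec t (\<lambda>k. 1 / a $ k)) (- b)"
proof -
  let ?n = "s + 2 * t" and ?T = "T_mat s t a b" and ?T' = "T_mat s t (vec t (\<lambda>k. 1 / a $ k)) (- b)"
  have pos: "a $ k \<noteq> 0" if "k < t" for k using a that by (force simp: pos_vecs_def)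
  have "?T * ?T' = 1\<^sub>m ?n"
  proof (rule eq_matI)
    fix i j assume ij: "i < dim_row (1\<^sub>m ?n :: real mat)" "j < dim_col (1\<^sub>m ?n :: real mat)"
    have ij': "i < ?n" "j < ?n" using ij by auto
    have eq: "(?T * ?T') $$ (i, j) = ?T $$ (i, i) * ?T' $$ (i, j) +
        (if Suc i < ?n then ?T $$ (i, Suc i) * ?T' $$ (Suc i, j) else 0)"
      by (rule T_mat_mult_index[OF T_mat_carrier ij'])
    show "(?T * ?T') $$ (i, j) = (1\<^sub>m ?n :: real mat) $$ (i, j)"
      using ij'(1)
    proof (cases rule: block_index_cases)
      case 1
      then show ?thesis unfolding eq using ij' by (simp add: T_mat_index_lt)
    next
      case (2 k)
      consider "j = i" | "j = Suc i" | "j \<noteq> i" "j \<noteq> Suc i" by blast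
      then show ?thesis
      proof cases
        case 1
        have "?T' $$ (Suc i, i) = 0" using 2 by (intro T_mat_eq_0) auto
        then show ?thesis unfolding eq using 1 2 pos b ij' by (simp add: T_mat_block)
      next
        case j: 2
        \<comment> \<open>The entry is a * (-b) + b * a, since the lower right entry of the inverse
          block is 1 / (1/a) = a.\<close>
        then show ?thesis unfolding eq using j 2 pos b ij' by (simp add: T_mat_block)
      next
        case 3
        then have "?T' $$ (i, j) = 0" "?T' $$ (Suc i, j) = 0"
          using 2 ij' by (auto intro!: T_mat_eq_0)
        then show ?thesis unfolding eq using 3 ij' by simp
      qed
    next
      case (3 k)
      have "Suc i < ?n \<Longrightarrow> ?T $$ (i, Suc i) = 0"
        using 3 ij' by (intro T_mat_eq_0) (auto simp: double_not_eq_Suc_double Suc_double_not_eq_double)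
      moreover have "i \<noteq> j \<Longrightarrow> ?T' $$ (i, j) = 0"
        using 3 ij' by (intro T_mat_eq_0) (auto simp: double_not_eq_Suc_double Suc_double_not_eq_double)
      ultimately show ?thesis unfolding eq using 3 pos b ij' by (auto simp: T_mat_block)
    qed
  qed (use carrier_matD[OF T_mat_carrier] in auto)
  note TT' = this
  \<comment> \<open>A left inverse and a right inverse of the same matrix coincide.\<close>
  have "mat_inv ?T = mat_inv ?T * (?T * ?T')"
    using TT' mat_inv_T_mat(1)[OF a, of s b] by simp
  also have "\<dots> = (mat_inv ?T * ?T) * ?T'"
    by (rule assoc_mult_mat[symmetric, OF mat_inv_T_mat(1)[OF a] T_mat_carrier T_mat_carrier])
  also have "\<dots> = ?T'"
    using mat_inv_T_mat(3)[OF a, of s b] left_mult_one_mat[OF T_mat_carrier] by simp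
  finally show ?thesis .
qed

section \<open>Entrywise bounds on a level set\<close>

lemma abs_mult_mat_le:
  fixes A B :: "real mat"
  assumes "A \<in> carrier_mat m n" "B \<in> carrier_mat n l" "i < m" "j < l"
    and "\<And>k. k < n \<Longrightarrow> \<bar>A $$ (i, k)\<bar> \<le> \<alpha>" "\<And>k. k < n \<Longrightarrow> \<bar>B $$ (k, j)\<bar> \<le> \<beta>"
  shows "\<bar>(A * B) $$ (i, j)\<bar> \<le> real n * (\<alpha> * \<beta>)"
proof -
  have "\<bar>(A * B) $$ (i, j)\<bar> \<le> (\<Sum>k<n. \<bar>A $$ (i, k) * B $$ (k, j)\<bar>)"
    unfolding mult_mat_index[OF assms(1-4)] by (rule sum_abs)
  also have "\<dots> \<le> (\<Sum>k<n. \<alpha> * \<beta>)"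
    using assms(5,6) by (intro sum_mono) (auto simp: abs_mult intro!: mult_mono order_trans[OF abs_ge_zero])
  finally show ?thesis by simp
qed

text \<open>Each squared entry is one summand of the squared norm of its row. Through
  \<open>Orth_subset_OB\<close> the bound serves for orthogonal matrices as well.\<close>

lemma abs_OB_le_1:
  assumes "S \<in> OB n" "i < n" "j < n"
  shows "\<bar>S $$ (i, j)\<bar> \<le> 1"
proof -
  have S: "S \<in> carrier_mat n n" and row: "L2_set (vec_index (row S i)) {..<n} = 1"
    using assms by (auto simp: OB_def)
  have "(\<Sum>k<n. (row S i $ k)\<^sup>2) = 1" using row by (simp add: L2_set_def)
  moreover have "(row S i $ j)\<^sup>2 \<le> (\<Sum>k<n. (row S i $ k)\<^sup>2)"
    using assms by (intro member_le_sum) auto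
  ultimately have "(S $$ (i, j))\<^sup>2 \<le> 1" using S assms by simp
  then show ?thesis by (simp add: abs_square_le_1)
qed

lemma Orth_mult_transpose:
  assumes "Q \<in> Orth n"
  shows "Q \<in> carrier_mat n n" "transpose_mat Q * Q = 1\<^sub>m n"
  using assms by (auto simp: Orth_def)

text \<open>An entry x has x^2 \<le> 2c, and 2|x| \<le> 1 + x^2 then gives a bound free of square
  roots.\<close>

lemma abs_index_le_of_frob_norm:
  assumes "1 / 2 * (frob_norm R)\<^sup>2 \<le> c" "i < dim_row R" "j < dim_col R"
  shows "\<bar>R $$ (i, j)\<bar> \<le> 1 + 2 * c"
proof -
  have "(R $$ (i, j))\<^sup>2 \<le> (\<Sum>ij\<in>{..<dim_row R} \<times> {..<dim_col R}. (R $$ ij)\<^sup>2)"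
    using assms by (intro member_le_sum) auto
  also have "\<dots> = (frob_norm R)\<^sup>2"
    by (simp add: frob_norm_def L2_set_def sum_nonneg)
  finally have "(R $$ (i, j))\<^sup>2 \<le> 2 * c" using assms by linarith
  moreover have "2 * \<bar>R $$ (i, j)\<bar> \<le> 1 + (R $$ (i, j))\<^sup>2"
    using sum_squares_bound[of 1 "\<bar>R $$ (i, j)\<bar>"] by simp
  ultimately show ?thesis using zero_le_power2[of "R $$ (i, j)"] by linarith
qed

lemma abs_ln_le:
  fixes x P :: real
  assumes "0 < x" "x \<le> P" "1 / x \<le> P"
  shows "\<bar>ln x\<bar> \<le> ln P"
proof -
  have "0 < P" using assms by linarith
  have "ln x \<le> ln P" using ln_mono[of x P] assms by simp
  moreover have "- ln x \<le> ln P" using ln_mono[of "1 / x" P] assms \<open>0 < P\<close> by (simp add: ln_div)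
  ultimately show ?thesis by linarith
qed

text \<open>\<open>V\<close> vanishes on the diagonal 2 x 2 blocks: it is zero on and below the
  diagonal and at the superdiagonal position of each block. As \<open>T_mat\<close> is block
  diagonal, the k-th diagonal block of \<open>M\<close> is that of \<open>D_mat\<close> conjugated
  by \<open>T2\<close>, so these two entries do not involve \<open>V\<close>.\<close>

lemma transformed_block_entries:
  fixes \<Lambda> :: "complex vec"
  assumes a: "a \<in> pos_vecs t" and b: "b \<in> carrier_vec t" and V: "V \<in> V_space (s + 2 * t) s t"
    and k: "k < t"
  defines "M \<equiv> T_mat s t a b * (D_mat s t \<Lambda> + V) * mat_inv (T_mat s t a b)"
  shows "M $$ (Suc (s + 2 * k), s + 2 * k) = - Im (\<Lambda> $ (s + 2 * k)) / (a $ k)\<^sup>2"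
    and "M $$ (s + 2 * k, Suc (s + 2 * k)) = Im (\<Lambda> $ (s + 2 * k)) * ((a $ k)\<^sup>2 + (b $ k)\<^sup>2)"
proof -
  let ?n = "s + 2 * t" and ?p = "s + 2 * k"
  define a' where "a' = vec t (\<lambda>k. 1 / a $ k)"
  define W where "W = D_mat s t \<Lambda> + V"
  have Vc: "V \<in> carrier_mat ?n ?n" "upper_triangular V" "\<And>i. i < ?n \<Longrightarrow> V $$ (i, i) = 0"
    "V $$ (?p, Suc ?p) = 0"
    using V k by (auto simp: V_space_def)
  have V0: "V $$ (Suc ?p, ?p) = 0"
    using upper_triangularD[OF Vc(2), of ?p "Suc ?p"] Vc(1) k by auto
  have Wc: "W \<in> carrier_mat ?n ?n" using Vc(1) by (simp add: W_def)
  have TW: "T_mat s t a b * W \<in> carrier_mat ?n ?n"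
    using T_mat_carrier Wc by (rule mult_carrier_mat)
  have p: "?p < ?n" "Suc ?p < ?n" using k by auto
  have W: "W $$ (?p, ?p) = Re (\<Lambda> $ ?p)" "W $$ (?p, Suc ?p) = Im (\<Lambda> $ ?p)"
    "W $$ (Suc ?p, ?p) = - Im (\<Lambda> $ ?p)" "W $$ (Suc ?p, Suc ?p) = Re (\<Lambda> $ ?p)"
    using Vc V0 p k D_mat_block[OF k, of s \<Lambda>] by (simp_all add: W_def)
  \<comment> \<open>No entry of a \<open>T_mat\<close> couples the block to its neighbours. Stated
    for arbitrary parameters, to cover the matrix as well as its inverse.\<close>
  have z1: "T_mat s t a b $$ (Suc ?p, Suc (Suc ?p)) = 0" if "Suc (Suc ?p) < ?n" for a b
    using that by (intro T_mat_eq_0) (auto simp: double_not_eq_Suc_double Suc_double_not_eq_double)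
  have z2: "T_mat s t a b $$ (?p - 1, ?p) = 0" if "0 < ?p" for a b
    using that p by (intro T_mat_eq_0) (auto simp: double_not_eq_Suc_double Suc_double_not_eq_double)
  have TWi: "(T_mat s t a b * W) $$ (?p, ?p) = a $ k * W $$ (?p, ?p) + b $ k * W $$ (Suc ?p, ?p)"
    "(T_mat s t a b * W) $$ (?p, Suc ?p) =
      a $ k * W $$ (?p, Suc ?p) + b $ k * W $$ (Suc ?p, Suc ?p)"
    "(T_mat s t a b * W) $$ (Suc ?p, ?p) = W $$ (Suc ?p, ?p) / a $ k"
    using T_mat_mult_index[OF Wc] z1 p k by (simp_all add: T_mat_block)
  have M: "M = T_mat s t a b * W * T_mat s t a' (- b)"
    unfolding M_def W_def a'_def mat_inv_T_mat_eq[OF a b] ..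
  have ak: "a $ k > 0" using a k by (simp add: pos_vecs_def)
  have "M $$ (Suc ?p, ?p) = (T_mat s t a b * W) $$ (Suc ?p, ?p) * a' $ k"
    unfolding M using mult_T_mat_index[OF TW] z2 p k by (simp add: T_mat_block)
  then show "M $$ (Suc ?p, ?p) = - Im (\<Lambda> $ ?p) / (a $ k)\<^sup>2"
    using k TWi W by (simp add: a'_def power2_eq_square)
  \<comment> \<open>Expanded, this is a * (a * Im + b * Re) - b * (a * Re - b * Im), in which the
    terms with the real part cancel.\<close>
  have "M $$ (?p, Suc ?p) = (T_mat s t a b * W) $$ (?p, Suc ?p) * (1 / a' $ k)
      + (T_mat s t a b * W) $$ (?p, ?p) * (- b) $ k"
    unfolding M using mult_T_mat_index[OF TW] p k by (simp add: T_mat_block)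
  then show "M $$ (?p, Suc ?p) = Im (\<Lambda> $ ?p) * ((a $ k)\<^sup>2 + (b $ k)\<^sup>2)"
    using k b TWi W by (simp add: a'_def power2_eq_square algebra_simps)
qed

lemma abs_T_mat_le:
  fixes a b :: "real vec"
  assumes "\<And>k. k < t \<Longrightarrow> \<bar>a $ k\<bar> \<le> P" "\<And>k. k < t \<Longrightarrow> \<bar>1 / a $ k\<bar> \<le> P"
    "\<And>k. k < t \<Longrightarrow> \<bar>b $ k\<bar> \<le> P" "1 \<le> P" "i < s + 2 * t" "j < s + 2 * t"
  shows "\<bar>T_mat s t a b $$ (i, j)\<bar> \<le> P"
proof (cases "T_mat s t a b $$ (i, j) = 0")
  case False
  from assms(5) show ?thesis
  proof (cases rule: block_index_cases)
    case 1
    then show ?thesis using assms by (simp add: T_mat_index_lt)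
  next
    case (2 k)
    then have "j = i \<or> j = Suc i" using False T_mat_eq_0[of i s t j a b] assms(5,6) by auto
    then show ?thesis using 2 assms(1,3) by (auto simp: T_mat_block)
  next
    case (3 k)
    then have "j = i" using False T_mat_eq_0[of i s t j a b] assms(5,6) by (auto simp: double_not_eq_Suc_double Suc_double_not_eq_double)
    then show ?thesis using 3 assms(2) by (auto simp: T_mat_block)
  qed
qed (use assms(4) in simp)

text \<open>Undoes a conjugation. It is used twice: to recover \<open>M\<close> from its conjugate
  by \<open>Q\<close>, and \<open>D_mat s t \<Lambda> + V\<close> from its conjugate by
  \<open>T_mat\<close>.\<close>

lemma middle_factor_eq:
  fixes P P' X :: "real mat"
  assumes "P \<in> carrier_mat n n" "P' \<in> carrier_mat n n" "X \<in> carrier_mat n n" "P' * P = 1\<^sub>m n"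
  shows "P' * (P * X * P') * P = X"
proof -
  have "P' * (P * X * P') * P = (P' * P) * X * (P' * P)"
    using assms(1-3) by (simp add: assoc_mult_mat[of _ n n _ n _ n])
  then show ?thesis using assms by simp
qed

text \<open>The bound is uniform over the level set. The vector \<open>a\<close> enters through its
  logarithm, the coordinate in which its geodesic distance is Euclidean.\<close>

lemma lev_bounds:
  assumes \<Lambda>: "spectrum_vec n s t \<Lambda>"
  obtains B where "\<And>S Q V a b i j. (S, Q, V, a, b) \<in> lev n s t \<Lambda> c \<Longrightarrow> i < n \<Longrightarrow> j < n \<Longrightarrow>
      \<bar>V $$ (i, j)\<bar> \<le> B"
    and "\<And>S Q V a b k. (S, Q, V, a, b) \<in> lev n s t \<Lambda> c \<Longrightarrow> k < t \<Longrightarrow>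
      \<bar>ln (a $ k)\<bar> \<le> B \<and> \<bar>b $ k\<bar> \<le> B"
proof -
  have n: "n = s + 2 * t" using \<Lambda> by (simp add: spectrum_vec_def)
  \<comment> \<open>A positive lower bound for the imaginary parts, uniform in \<open>k\<close>;
    inserting 1 keeps the minimum defined for \<open>t = 0\<close>.\<close>
  obtain \<mu> where \<mu>: "0 < \<mu>" "\<And>k. k < t \<Longrightarrow> \<mu> \<le> \<bar>Im (\<Lambda> $ (s + 2 * k))\<bar>"
  proof -
    let ?I = "(\<lambda>k. \<bar>Im (\<Lambda> $ (s + 2 * k))\<bar>) ` {..<t}"
    have "\<bar>Im (\<Lambda> $ (s + 2 * k))\<bar> > 0" if "k < t" for k
      using \<Lambda> that by (auto simp: spectrum_vec_def complex_is_Real_iff)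
    then have "0 < Min (insert 1 ?I)" by (subst Min_gr_iff) auto
    moreover have "Min (insert 1 ?I) \<le> \<bar>Im (\<Lambda> $ (s + 2 * k))\<bar>" if "k < t" for k
      using that by (intro Min_le) auto
    ultimately show thesis using that by blast
  qed
  define d where "d = Max (insert 0 ((\<lambda>ij. \<bar>D_mat s t \<Lambda> $$ ij\<bar>) ` ({..<n} \<times> {..<n})))"
  have d: "\<bar>D_mat s t \<Lambda> $$ (i, j)\<bar> \<le> d" if "i < n" "j < n" for i j
    unfolding d_def using that by (intro Max_ge) auto
  \<comment> \<open>\<open>K\<close> bounds the entries of \<open>N = Q M Q^T\<close>: 1 for those
    of \<open>S \<circ> S\<close> plus 1 + 2c for the residual. \<open>L\<close> bounds
    \<open>M\<close>, regained from \<open>N\<close> by two multiplications with orthogonal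
    matrices. \<open>P\<close> bounds a, 1/a and b; the absolute value of \<open>L\<close> ensures
    \<open>1 \<le> P\<close> even if a negative \<open>c\<close> makes \<open>L\<close>
    negative.\<close>
  define K where "K = 2 + 2 * c"
  define L where "L = real n * (real n * (1 * K) * 1)"
  define P where "P = 1 + \<bar>L\<bar> / \<mu>"
  have P1: "1 \<le> P" using \<mu>(1) by (simp add: P_def)
  have *: "(\<forall>i<n. \<forall>j<n. \<bar>V $$ (i, j)\<bar> \<le> real n * (real n * (P * L) * P) + d) \<and>
      (\<forall>k<t. \<bar>ln (a $ k)\<bar> \<le> ln P \<and> \<bar>b $ k\<bar> \<le> P)"
    if x: "(S, Q, V, a, b) \<in> lev n s t \<Lambda> c" for S Q V a b
  proof -
    have S: "S \<in> OB n" and Q: "Q \<in> Orth n" and V: "V \<in> V_space n s t" and a: "a \<in> pos_vecs t"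
      and b: "b \<in> carrier_vec t"
      and obj: "objective s t \<Lambda> (S, Q, V, a, b) \<le> c"
      using x by (auto simp: lev_def M_set_def)
    have Sc: "S \<in> carrier_mat n n" and Vc: "V \<in> carrier_mat n n"
      using S V by (auto simp: OB_def V_space_def)
    note Qc = Orth_mult_transpose[OF Q]
    let ?T = "T_mat s t a b" and ?T' = "mat_inv (T_mat s t a b)"
    define W where "W = D_mat s t \<Lambda> + V"
    define M where "M = ?T * W * ?T'"
    define N where "N = Q * M * transpose_mat Q"
    have T: "?T \<in> carrier_mat n n" and T': "?T' \<in> carrier_mat n n" and T'T: "?T' * ?T = 1\<^sub>m n"
      using mat_inv_T_mat[OF a, of s b] by (auto simp: n)
    have W: "W \<in> carrier_mat n n" using Vc by (auto simp: W_def n)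
    have M: "M \<in> carrier_mat n n" using T T' W by (simp add: M_def)
    have QT: "transpose_mat Q \<in> carrier_mat n n" using Qc by simp
    have N: "N \<in> carrier_mat n n" using Qc QT M by (simp add: N_def)
    have N_eq: "Q * ?T * W * ?T' * transpose_mat Q = N"
      unfolding N_def M_def using Qc(1) QT T T' W
      by (simp add: assoc_mult_mat[of _ n n _ n _ n])
    have Q1: "\<bar>Q $$ (i, j)\<bar> \<le> 1" if "i < n" "j < n" for i j
      using abs_OB_le_1 Q Orth_subset_OB that by blast
    have N_le: "\<bar>N $$ (i, j)\<bar> \<le> K" if ij: "i < n" "j < n" for i j
    proof -
      let ?R = "hadamard S S - N"
      have "\<bar>?R $$ (i, j)\<bar> \<le> 1 + 2 * c"
        using obj N ij unfolding objective.simps W_def[symmetric] N_eq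
        by (intro abs_index_le_of_frob_norm) auto
      moreover have "?R $$ (i, j) = S $$ (i, j) * S $$ (i, j) - N $$ (i, j)"
        using ij Sc N by (simp add: hadamard_def)
      moreover have "\<bar>S $$ (i, j) * S $$ (i, j)\<bar> \<le> 1"
        unfolding abs_mult by (rule mult_le_one[OF abs_OB_le_1[OF S ij] abs_ge_zero abs_OB_le_1[OF S ij]])
      ultimately show ?thesis unfolding K_def by linarith
    qed
    have M_eq: "M = transpose_mat Q * N * Q"
      unfolding N_def using middle_factor_eq[OF Qc(1) QT M Qc(2)] by simp
    have M_le: "\<bar>M $$ (i, j)\<bar> \<le> L" if "i < n" "j < n" for i j
      unfolding M_eq L_def using Qc(1) QT N Q1 N_le that
      by (intro abs_mult_mat_le[of _ n n _ n]) (auto intro!: abs_mult_mat_le[of _ n n _ n])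
    \<comment> \<open>The two off-diagonal entries of the block are at most \<open>L\<close> in
      absolute value; replacing the factor |Im \<lambda>| by its lower bound \<mu> and dividing
      gives both estimates.\<close>
    have ab: "(a $ k)\<^sup>2 + (b $ k)\<^sup>2 \<le> \<bar>L\<bar> / \<mu>" "(1 / a $ k)\<^sup>2 \<le> \<bar>L\<bar> / \<mu>" if k: "k < t" for k
    proof -
      let ?q = "Im (\<Lambda> $ (s + 2 * k))"
      note ent = transformed_block_entries[OF a b V[unfolded n] k, of \<Lambda>, folded W_def, folded M_def]
      have "\<bar>?q * ((a $ k)\<^sup>2 + (b $ k)\<^sup>2)\<bar> \<le> L" "\<bar>- ?q / (a $ k)\<^sup>2\<bar> \<le> L"
        unfolding ent[symmetric] using k by (auto intro!: M_le simp: n)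
      then have "\<bar>?q\<bar> * ((a $ k)\<^sup>2 + (b $ k)\<^sup>2) \<le> \<bar>L\<bar>" "\<bar>?q\<bar> * (1 / a $ k)\<^sup>2 \<le> \<bar>L\<bar>"
        by (simp_all add: abs_mult power_divide)
      moreover have "\<mu> * ((a $ k)\<^sup>2 + (b $ k)\<^sup>2) \<le> \<bar>?q\<bar> * ((a $ k)\<^sup>2 + (b $ k)\<^sup>2)"
        "\<mu> * (1 / a $ k)\<^sup>2 \<le> \<bar>?q\<bar> * (1 / a $ k)\<^sup>2"
        using \<mu>(2)[OF k] by (intro mult_right_mono; simp)+
      ultimately show "(a $ k)\<^sup>2 + (b $ k)\<^sup>2 \<le> \<bar>L\<bar> / \<mu>" "(1 / a $ k)\<^sup>2 \<le> \<bar>L\<bar> / \<mu>"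
        using \<mu>(1) by (simp_all add: pos_le_divide_eq mult.commute[of _ \<mu>])
    qed
    \<comment> \<open>Again 2|x| \<le> 1 + x^2 in place of a square root.\<close>
    have sq: "\<bar>x\<bar> \<le> P" if "x\<^sup>2 \<le> \<bar>L\<bar> / \<mu>" for x :: real
      using sum_squares_bound[of 1 "\<bar>x\<bar>"] that zero_le_power2[of x] by (simp add: P_def)
    have pos: "0 < a $ k" if "k < t" for k using a that by (simp add: pos_vecs_def)
    have aP: "\<bar>a $ k\<bar> \<le> P" "\<bar>1 / a $ k\<bar> \<le> P" "\<bar>b $ k\<bar> \<le> P" if k: "k < t" for k
      using ab[OF k] zero_le_power2[of "a $ k"] zero_le_power2[of "b $ k"]
      by (intro sq; linarith)+
    \<comment> \<open>The bounds on the parameters are invariant under passing from (a, b) to (1/a,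
      -b), so \<open>P\<close> bounds the inverse too.\<close>
    have TP: "\<bar>?T $$ (i, j)\<bar> \<le> P" "\<bar>?T' $$ (i, j)\<bar> \<le> P" if "i < n" "j < n" for i j
      using abs_T_mat_le[of t a P b i s j]
        abs_T_mat_le[of t "vec t (\<lambda>k. 1 / a $ k)" P "- b" i s j] aP P1 b that
      by (auto simp: mat_inv_T_mat_eq[OF a b] n)
    have W_eq: "W = ?T' * M * ?T"
      unfolding M_def using middle_factor_eq[OF T T' W T'T] by simp
    have WB: "\<bar>W $$ (i, j)\<bar> \<le> real n * (real n * (P * L) * P)" if "i < n" "j < n" for i j
      unfolding W_eq using T T' M TP M_le that
      by (intro abs_mult_mat_le[of _ n n _ n]) (auto intro!: abs_mult_mat_le[of _ n n _ n])
    have "\<bar>V $$ (i, j)\<bar> \<le> real n * (real n * (P * L) * P) + d" if ij: "i < n" "j < n" for i j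
    proof -
      have "W $$ (i, j) = D_mat s t \<Lambda> $$ (i, j) + V $$ (i, j)"
        using ij Vc by (simp add: W_def)
      then show ?thesis using WB[OF ij] d[OF ij] by linarith
    qed
    moreover have "\<bar>ln (a $ k)\<bar> \<le> ln P" if "k < t" for k
      using aP[OF that] pos[OF that] by (intro abs_ln_le) auto
    ultimately show ?thesis using aP by blast
  qed
  \<comment> \<open>Since \<open>1 \<le> P\<close>, both \<open>ln P\<close> and \<open>P\<close>
    are nonnegative, so their sum dominates each of them.\<close>
  define B where "B = max (real n * (real n * (P * L) * P) + d) (ln P + P)"
  show thesis
  proof
    fix S Q V a b assume x: "(S, Q, V, a, b) \<in> lev n s t \<Lambda> c"
    show "\<bar>V $$ (i, j)\<bar> \<le> B"
      if "i < n" "j < n" for i j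
      using *[OF x] that by (simp add: B_def le_max_iff_disj)
    show "\<bar>ln (a $ k)\<bar> \<le> B \<and>
        \<bar>b $ k\<bar> \<le> B" if "k < t" for k
      using *[OF x] that P1 ln_ge_zero[OF P1] by (fastforce simp: B_def le_max_iff_disj)
  qed
qed

section \<open>Compactness of level sets: subsequences and entrywise limits\<close>

lemma convergent_subseq_finite:
  fixes \<sigma> :: "nat \<Rightarrow> 'a" and F :: "('a \<Rightarrow> real) set"
  assumes "finite F" "\<And>g. g \<in> F \<Longrightarrow> bounded (range (g \<circ> \<sigma>))"
  shows "\<exists>r. strict_mono r \<and> (\<forall>g\<in>F. convergent (\<lambda>m. g (\<sigma> (r m))))"
  using assms
proof (induction F)
  case empty
  show ?case by (intro exI[of _ id]) (simp add: strict_mono_def)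
next
  case (insert g F)
  then obtain r where r: "strict_mono r" "\<And>h. h \<in> F \<Longrightarrow> convergent (\<lambda>m. h (\<sigma> (r m)))"
    by blast
  \<comment> \<open>Bolzano-Weierstrass for the new function along \<open>r\<close>; the refinement
    \<open>r \<circ> q\<close> keeps the limits already obtained for \<open>F\<close>.\<close>
  have "bounded (range (\<lambda>m. g (\<sigma> (r m))))"
    using insert.prems[of g] by (rule bounded_subset) auto
  then obtain l q where q: "strict_mono q" "((\<lambda>m. g (\<sigma> (r m))) \<circ> q) \<longlonglongrightarrow> l"
    using bounded_imp_convergent_subsequence by blast
  have "convergent (\<lambda>m. h (\<sigma> ((r \<circ> q) m)))" if "h \<in> insert g F" for h
    using that
  proof
    assume "h = g"
    then show ?thesis using q(2) by (auto simp: o_def convergent_def)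
  next
    assume "h \<in> F"
    then show ?thesis using convergent_subseq_convergent[OF r(2) q(1)] by (simp add: o_def)
  qed
  moreover have "strict_mono (r \<circ> q)" using r(1) q(1) by (rule strict_mono_o)
  ultimately show ?case by blast
qed

lemma tendsto_L2_set:
  assumes "\<And>i. i \<in> A \<Longrightarrow> ((\<lambda>m. f m i) \<longlongrightarrow> g i) F"
  shows "((\<lambda>m. L2_set (f m) A) \<longlongrightarrow> L2_set g A) F"
  unfolding L2_set_def using assms by (intro tendsto_intros) auto

text \<open>Entrywise convergence. The carrier conditions are part of the notion so that matrix
  operations pass to the limit with no separate dimension assumptions.\<close>

definition mat_lim :: "nat \<Rightarrow> (nat \<Rightarrow> real mat) \<Rightarrow> real mat \<Rightarrow> bool" where
  "mat_lim n X A \<longleftrightarrow> (\<forall>m. X m \<in> carrier_mat n n) \<and> A \<in> carrier_mat n n \<and>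
     (\<forall>i<n. \<forall>j<n. (\<lambda>m. X m $$ (i, j)) \<longlonglongrightarrow> A $$ (i, j))"

lemma mat_limI:
  "(\<And>m. X m \<in> carrier_mat n n) \<Longrightarrow> A \<in> carrier_mat n n \<Longrightarrow>
    (\<And>i j. i < n \<Longrightarrow> j < n \<Longrightarrow> (\<lambda>m. X m $$ (i, j)) \<longlonglongrightarrow> A $$ (i, j)) \<Longrightarrow> mat_lim n X A"
  and mat_limD: "mat_lim n X A \<Longrightarrow> X m \<in> carrier_mat n n" "mat_lim n X A \<Longrightarrow> A \<in> carrier_mat n n"
    "mat_lim n X A \<Longrightarrow> i < n \<Longrightarrow> j < n \<Longrightarrow> (\<lambda>m. X m $$ (i, j)) \<longlonglongrightarrow> A $$ (i, j)"
  by (auto simp: mat_lim_def)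

lemma mat_lim_dim:
  "mat_lim n X A \<Longrightarrow> dim_row (X m) = n" "mat_lim n X A \<Longrightarrow> dim_col (X m) = n"
  "mat_lim n X A \<Longrightarrow> dim_row A = n" "mat_lim n X A \<Longrightarrow> dim_col A = n"
  using carrier_matD[OF mat_limD(1)] carrier_matD[OF mat_limD(2)] by blast+

lemma mat_lim_const: "A \<in> carrier_mat n n \<Longrightarrow> mat_lim n (\<lambda>m. A) A"
  by (simp add: mat_lim_def)

lemma mat_lim_add:
  assumes "mat_lim n X A" "mat_lim n Y B"
  shows "mat_lim n (\<lambda>m. X m + Y m) (A + B)"
proof (rule mat_limI)
  fix i j assume ij: "i < n" "j < n"
  show "(\<lambda>m. (X m + Y m) $$ (i, j)) \<longlonglongrightarrow> (A + B) $$ (i, j)"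
    using tendsto_add[OF mat_limD(3)[OF assms(1) ij] mat_limD(3)[OF assms(2) ij]] ij
    by (simp add: mat_lim_dim[OF assms(1)] mat_lim_dim[OF assms(2)])
qed (rule carrier_matI; simp add: mat_lim_dim[OF assms(1)] mat_lim_dim[OF assms(2)])+

lemma mat_lim_diff:
  assumes "mat_lim n X A" "mat_lim n Y B"
  shows "mat_lim n (\<lambda>m. X m - Y m) (A - B)"
proof (rule mat_limI)
  fix i j assume ij: "i < n" "j < n"
  show "(\<lambda>m. (X m - Y m) $$ (i, j)) \<longlonglongrightarrow> (A - B) $$ (i, j)"
    using tendsto_diff[OF mat_limD(3)[OF assms(1) ij] mat_limD(3)[OF assms(2) ij]] ij
    by (simp add: mat_lim_dim[OF assms(1)] mat_lim_dim[OF assms(2)])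
qed (rule carrier_matI; simp add: mat_lim_dim[OF assms(1)] mat_lim_dim[OF assms(2)])+

lemma mat_lim_hadamard:
  assumes "mat_lim n X A" "mat_lim n Y B"
  shows "mat_lim n (\<lambda>m. hadamard (X m) (Y m)) (hadamard A B)"
proof (rule mat_limI)
  fix i j assume ij: "i < n" "j < n"
  show "(\<lambda>m. (hadamard (X m) (Y m)) $$ (i, j)) \<longlonglongrightarrow> (hadamard A B) $$ (i, j)"
    using tendsto_mult[OF mat_limD(3)[OF assms(1) ij] mat_limD(3)[OF assms(2) ij]] ij
    by (simp add: hadamard_def mat_lim_dim[OF assms(1)] mat_lim_dim[OF assms(2)])
qed (rule carrier_matI; simp add: hadamard_def mat_lim_dim[OF assms(1)] mat_lim_dim[OF assms(2)])+

lemma mat_lim_transpose: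
  assumes "mat_lim n X A"
  shows "mat_lim n (\<lambda>m. transpose_mat (X m)) (transpose_mat A)"
proof (rule mat_limI)
  fix i j assume ij: "i < n" "j < n"
  show "(\<lambda>m. transpose_mat (X m) $$ (i, j)) \<longlonglongrightarrow> transpose_mat A $$ (i, j)"
    using mat_limD(3)[OF assms ij(2,1)] ij by (simp add: mat_lim_dim[OF assms])
qed (rule carrier_matI; simp add: mat_lim_dim[OF assms])+

lemma mat_lim_mult:
  assumes "mat_lim n X A" "mat_lim n Y B"
  shows "mat_lim n (\<lambda>m. X m * Y m) (A * B)"
proof (rule mat_limI)
  fix i j assume ij: "i < n" "j < n"
  show "(\<lambda>m. (X m * Y m) $$ (i, j)) \<longlonglongrightarrow> (A * B) $$ (i, j)"
    unfolding mult_mat_index[OF mat_limD(1)[OF assms(1)] mat_limD(1)[OF assms(2)] ij]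
      mult_mat_index[OF mat_limD(2)[OF assms(1)] mat_limD(2)[OF assms(2)] ij]
    using ij by (intro tendsto_sum tendsto_mult mat_limD(3)[OF assms(1)] mat_limD(3)[OF assms(2)]) auto
qed (rule carrier_matI; simp add: mat_lim_dim[OF assms(1)] mat_lim_dim[OF assms(2)])+

lemma mat_lim_T_mat:
  fixes a b :: "nat \<Rightarrow> real vec" and a0 b0 :: "real vec"
  assumes "\<And>k. k < t \<Longrightarrow> (\<lambda>m. a m $ k) \<longlonglongrightarrow> a0 $ k" "\<And>k. k < t \<Longrightarrow> (\<lambda>m. b m $ k) \<longlonglongrightarrow> b0 $ k"
    and "\<And>k. k < t \<Longrightarrow> a0 $ k \<noteq> 0"
  shows "mat_lim (s + 2 * t) (\<lambda>m. T_mat s t (a m) (b m)) (T_mat s t a0 b0)"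
proof (rule mat_limI)
  fix i j assume ij: "i < s + 2 * t" "j < s + 2 * t"
  have inv: "k < t \<Longrightarrow> (\<lambda>m. 1 / a m $ k) \<longlonglongrightarrow> 1 / a0 $ k" for k
    using assms(1,3) by (intro tendsto_divide tendsto_const)
  show "(\<lambda>m. T_mat s t (a m) (b m) $$ (i, j)) \<longlonglongrightarrow> T_mat s t a0 b0 $$ (i, j)"
    using ij(1)
  proof (cases rule: block_index_cases)
    case 1
    then show ?thesis using ij by (simp add: T_mat_index_lt)
  next
    case (2 k)
    consider "j = i" | "j = Suc i" | "j \<noteq> i" "j \<noteq> Suc i" by blast
    then show ?thesis
    proof cases
      case 3
      then have "T_mat s t a b $$ (i, j) = 0" for a b using 2 ij by (intro T_mat_eq_0) auto
      then show ?thesis by simp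
    qed (use 2 assms in \<open>simp_all add: T_mat_block\<close>)
  next
    case (3 k)
    show ?thesis
    proof (cases "j = i")
      case False
      then have "T_mat s t a b $$ (i, j) = 0" for a b
        using 3 ij by (intro T_mat_eq_0) (auto simp: double_not_eq_Suc_double Suc_double_not_eq_double)
      then show ?thesis by simp
    qed (use 3 inv in \<open>simp add: T_mat_block\<close>)
  qed
qed simp_all

lemma mat_dist_tendsto_0: "mat_lim n X A \<Longrightarrow> (\<lambda>m. mat_dist n (X m) A) \<longlonglongrightarrow> 0"
  using tendsto_L2_set[of "{..<n} \<times> {..<n}" "\<lambda>m ij. X m $$ ij - A $$ ij" "\<lambda>_. 0" sequentially]
  by (auto simp: mat_dist_def mat_lim_def L2_set_0' LIM_zero)

lemma frob_norm_tendsto: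
  assumes "mat_lim n X A"
  shows "(\<lambda>m. frob_norm (X m)) \<longlonglongrightarrow> frob_norm A"
proof -
  have "(\<lambda>m. L2_set (\<lambda>ij. X m $$ ij) ({..<n} \<times> {..<n})) \<longlonglongrightarrow> L2_set (\<lambda>ij. A $$ ij) ({..<n} \<times> {..<n})"
    using assms by (intro tendsto_L2_set) (auto intro: mat_limD)
  then show ?thesis
    by (simp add: frob_norm_def mat_lim_dim[OF assms])
qed

lemma OB_iff:
  "S \<in> OB n \<longleftrightarrow> S \<in> carrier_mat n n \<and> (\<forall>i<n. L2_set (\<lambda>j. S $$ (i, j)) {..<n} = 1)"
proof -
  have "L2_set (vec_index (row S i)) {..<n} = L2_set (\<lambda>j. S $$ (i, j)) {..<n}"
    if "S \<in> carrier_mat n n" "i < n" for i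
    using that by (intro L2_set_cong) auto
  then show ?thesis by (auto simp: OB_def)
qed

lemma OB_closed:
  assumes "mat_lim n X A" "\<And>m. X m \<in> OB n"
  shows "A \<in> OB n"
  unfolding OB_iff
proof (intro conjI allI impI)
  fix i assume i: "i < n"
  have "(\<lambda>m. L2_set (\<lambda>j. X m $$ (i, j)) {..<n}) \<longlonglongrightarrow> L2_set (\<lambda>j. A $$ (i, j)) {..<n}"
    using assms i by (intro tendsto_L2_set) (auto intro: mat_limD)
  then show "L2_set (\<lambda>j. A $$ (i, j)) {..<n} = 1"
    using assms(2) i by (simp add: OB_iff LIMSEQ_const_iff)
qed (rule mat_limD[OF assms(1)])

lemma Orth_closed:
  assumes "mat_lim n X A" "\<And>m. X m \<in> Orth n"
  shows "A \<in> Orth n"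
proof -
  have A: "A \<in> carrier_mat n n" by (rule mat_limD[OF assms(1)])
  \<comment> \<open>The products \<open>transpose_mat (X m) * X m\<close> form a constant sequence
    of identity matrices, so uniqueness of limits identifies
    \<open>transpose_mat A * A\<close>.\<close>
  have lim: "mat_lim n (\<lambda>m. 1\<^sub>m n) (transpose_mat A * A)"
    using mat_lim_mult[OF mat_lim_transpose[OF assms(1)] assms(1)]
    by (simp add: Orth_mult_transpose(2)[OF assms(2)])
  have "1\<^sub>m n $$ (i, j) = (transpose_mat A * A) $$ (i, j)" if "i < n" "j < n" for i j
    using mat_limD(3)[OF lim that] by (simp add: LIMSEQ_const_iff del: index_mult_mat(1) index_one_mat(1))
  then have "transpose_mat A * A = 1\<^sub>m n"
    using A by (intro eq_matI) (auto simp del: index_mult_mat(1) index_one_mat(1))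
  then show ?thesis using A by (simp add: Orth_def)
qed

text \<open>Membership is the vanishing of certain entries, which entrywise limits preserve;
  \<open>s + 2 * t \<le> n\<close> puts the prescribed superdiagonal positions inside the
  matrix.\<close>

lemma V_space_closed:
  assumes "mat_lim n X A" "\<And>m. X m \<in> V_space n s t" "s + 2 * t \<le> n"
  shows "A \<in> V_space n s t"
proof -
  have A: "A \<in> carrier_mat n n" by (rule mat_limD[OF assms(1)])
  have zero: "A $$ (i, j) = 0" if "i < n" "j < n" "\<And>m. X m $$ (i, j) = 0" for i j
    using mat_limD(3)[OF assms(1) that(1,2)] that(3) by (simp add: LIMSEQ_const_iff)
  have X: "X m \<in> carrier_mat n n" "upper_triangular (X m)"
    "\<And>i. i < n \<Longrightarrow> X m $$ (i, i) = 0" "\<And>j. j < t \<Longrightarrow> X m $$ (s + 2 * j, s + 2 * j + 1) = 0" for m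
    using assms(2)[of m] by (auto simp: V_space_def)
  have "upper_triangular A"
  proof (rule upper_triangularI)
    fix i j assume "j < i" "i < dim_row A"
    then show "A $$ (i, j) = 0"
      using A upper_triangularD[OF X(2), of j i] carrier_matD[OF X(1)] by (intro zero) auto
  qed
  then show ?thesis using A X zero assms(3) by (auto simp: V_space_def)
qed

lemma objective_tendsto:
  fixes a b :: "nat \<Rightarrow> real vec" and a0 b0 :: "real vec"
  assumes "mat_lim n S S0" "mat_lim n Q Q0" "mat_lim n V V0"
    and ab: "\<And>m. a m \<in> pos_vecs t" "a0 \<in> pos_vecs t" "\<And>m. b m \<in> carrier_vec t" "b0 \<in> carrier_vec t"
    and a: "\<And>k. k < t \<Longrightarrow> (\<lambda>m. a m $ k) \<longlonglongrightarrow> a0 $ k"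
    and b: "\<And>k. k < t \<Longrightarrow> (\<lambda>m. b m $ k) \<longlonglongrightarrow> b0 $ k"
    and n: "n = s + 2 * t"
  shows "(\<lambda>m. objective s t \<Lambda> (S m, Q m, V m, a m, b m)) \<longlonglongrightarrow> objective s t \<Lambda> (S0, Q0, V0, a0, b0)"
proof -
  have a0: "a0 $ k \<noteq> 0" if "k < t" for k using ab(2) that by (force simp: pos_vecs_def)
  have T: "mat_lim n (\<lambda>m. T_mat s t (a m) (b m)) (T_mat s t a0 b0)"
    unfolding n using a b a0 by (rule mat_lim_T_mat)
  have ai: "(\<lambda>m. 1 / a m $ k) \<longlonglongrightarrow> 1 / a0 $ k" if "k < t" for k
    using a a0 that by (intro tendsto_divide tendsto_const)
  have bi: "(\<lambda>m. (- b m) $ k) \<longlonglongrightarrow> (- b0) $ k" if "k < t" for k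
    using tendsto_minus[OF b[OF that]] ab(3,4) that by (simp add: carrier_vecD[OF ab(3)])
  \<comment> \<open>The inverses are \<open>T_mat\<close> matrices with parameters 1/a and -b, which
    converge because the limit of \<open>a\<close> has no zero component.\<close>
  have T': "mat_lim n (\<lambda>m. mat_inv (T_mat s t (a m) (b m))) (mat_inv (T_mat s t a0 b0))"
    unfolding mat_inv_T_mat_eq[OF ab(1,3)] mat_inv_T_mat_eq[OF ab(2,4)] n
    using ai a0 bi by (intro mat_lim_T_mat) simp_all
  have D: "mat_lim n (\<lambda>m. D_mat s t \<Lambda>) (D_mat s t \<Lambda>)"
    unfolding n by (rule mat_lim_const[OF D_mat_carrier])
  show ?thesis
    unfolding objective.simps
    by (intro tendsto_mult tendsto_const tendsto_power frob_norm_tendsto[of n] mat_lim_diff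
        mat_lim_hadamard mat_lim_mult mat_lim_add mat_lim_transpose assms(1-3) T T' D)
qed

text \<open>Sequential compactness together with convergence of the objective values along the same
  subsequence; the latter lets a minimizing sequence be evaluated in the limit.\<close>

lemma lev_sequence:
  fixes \<sigma> :: "nat \<Rightarrow> point"
  assumes \<Lambda>: "spectrum_vec n s t \<Lambda>" and \<sigma>: "\<And>m. \<sigma> m \<in> lev n s t \<Lambda> c"
  obtains r x where "strict_mono r" "x \<in> lev n s t \<Lambda> c"
    "limitin (M_topology n s t) (\<sigma> \<circ> r) x sequentially"
    "(\<lambda>m. objective s t \<Lambda> (\<sigma> (r m))) \<longlonglongrightarrow> objective s t \<Lambda> x"
proof -
  have n: "n = s + 2 * t" using \<Lambda> by (simp add: spectrum_vec_def)
  \<comment> \<open>The components become functions on points, so that all real coordinates of a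
    point can be collected in one finite set of functions.\<close>
  define S Q V a b where "S x = fst x" and "Q x = fst (snd x)" and "V x = fst (snd (snd x))"
    and "a x = fst (snd (snd (snd x)))" and "b x = snd (snd (snd (snd x)))" for x :: point
  note defs = S_def Q_def V_def a_def b_def
  have \<sigma>_eq: "\<sigma> m = (S (\<sigma> m), Q (\<sigma> m), V (\<sigma> m), a (\<sigma> m), b (\<sigma> m))" for m
    by (simp add: defs)
  have mem: "S (\<sigma> m) \<in> OB n" "Q (\<sigma> m) \<in> Orth n" "V (\<sigma> m) \<in> V_space n s t"
    "a (\<sigma> m) \<in> pos_vecs t" "b (\<sigma> m) \<in> carrier_vec t" for m
    using \<sigma>[of m] by (auto simp: defs lev_def M_set_def)
  obtain B where B: "\<And>S Q V a b i j. (S, Q, V, a, b) \<in> lev n s t \<Lambda> c \<Longrightarrow> i < n \<Longrightarrow> j < n \<Longrightarrow>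
      \<bar>V $$ (i, j)\<bar> \<le> B"
    "\<And>S Q V a b k. (S, Q, V, a, b) \<in> lev n s t \<Lambda> c \<Longrightarrow> k < t \<Longrightarrow>
      \<bar>ln (a $ k)\<bar> \<le> B \<and> \<bar>b $ k\<bar> \<le> B"
    by (rule lev_bounds[OF \<Lambda>]) blast
  \<comment> \<open>The coordinate of \<open>a\<close> is its logarithm: this is what
    \<open>lev_bounds\<close> bounds, and its limit keeps \<open>a\<close> away from 0.\<close>
  define F where "F = (\<lambda>ij x. S x $$ ij) ` ({..<n} \<times> {..<n}) \<union> (\<lambda>ij x. Q x $$ ij) ` ({..<n} \<times> {..<n})
    \<union> (\<lambda>ij x. V x $$ ij) ` ({..<n} \<times> {..<n}) \<union> (\<lambda>k x. ln (a x $ k)) ` {..<t}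
    \<union> (\<lambda>k x. b x $ k) ` {..<t}"
  have \<sigma>': "(S (\<sigma> m), Q (\<sigma> m), V (\<sigma> m), a (\<sigma> m), b (\<sigma> m)) \<in> lev n s t \<Lambda> c" for m
    using \<sigma>[of m] by (simp add: defs)
  have Q_OB: "Q (\<sigma> m) \<in> OB n" for m using mem(2) Orth_subset_OB by blast
  have "\<bar>S (\<sigma> m) $$ (i, j)\<bar> \<le> max 1 B" "\<bar>Q (\<sigma> m) $$ (i, j)\<bar> \<le> max 1 B"
    "\<bar>V (\<sigma> m) $$ (i, j)\<bar> \<le> max 1 B" if "i < n" "j < n" for m i j
    using that abs_OB_le_1[OF mem(1)] abs_OB_le_1[OF Q_OB] B(1)[OF \<sigma>'] by (simp_all add: le_max_iff_disj)
  moreover have "\<bar>ln (a (\<sigma> m) $ k)\<bar> \<le> max 1 B" "\<bar>b (\<sigma> m) $ k\<bar> \<le> max 1 B" if "k < t" for m k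
    using that B(2)[OF \<sigma>'] by (simp_all add: le_max_iff_disj)
  ultimately have "\<bar>g (\<sigma> m)\<bar> \<le> max 1 B" if "g \<in> F" for g m
    using that unfolding F_def by auto
  then have "bounded (range (g \<circ> \<sigma>))" if "g \<in> F" for g
    using that by (auto simp: bounded_iff intro!: exI[of _ "max 1 B"])
  moreover have "finite F" by (simp add: F_def)
  ultimately obtain r where r: "strict_mono r"
    and conv: "\<And>g. g \<in> F \<Longrightarrow> convergent (\<lambda>m. g (\<sigma> (r m)))"
    using convergent_subseq_finite[of F \<sigma>] by blast
  define S0 where "S0 = mat n n (\<lambda>ij. lim (\<lambda>m. S (\<sigma> (r m)) $$ ij))"
  define Q0 where "Q0 = mat n n (\<lambda>ij. lim (\<lambda>m. Q (\<sigma> (r m)) $$ ij))"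
  define V0 where "V0 = mat n n (\<lambda>ij. lim (\<lambda>m. V (\<sigma> (r m)) $$ ij))"
  \<comment> \<open>As an exponential the limit is positive, hence stays in the parameter
    set.\<close>
  define a0 where "a0 = vec t (\<lambda>k. exp (lim (\<lambda>m. ln (a (\<sigma> (r m)) $ k))))"
  define b0 where "b0 = vec t (\<lambda>k. lim (\<lambda>m. b (\<sigma> (r m)) $ k))"
  have S0: "mat_lim n (\<lambda>m. S (\<sigma> (r m))) S0"
    using mem by (intro mat_limI)
      (auto simp: S0_def OB_def F_def intro!: conv[unfolded convergent_LIMSEQ_iff])
  have Q0: "mat_lim n (\<lambda>m. Q (\<sigma> (r m))) Q0"
    using mem by (intro mat_limI)
      (auto simp: Q0_def Orth_def F_def intro!: conv[unfolded convergent_LIMSEQ_iff])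
  have V0: "mat_lim n (\<lambda>m. V (\<sigma> (r m))) V0"
    using mem by (intro mat_limI)
      (auto simp: V0_def V_space_def F_def intro!: conv[unfolded convergent_LIMSEQ_iff])
  have lna: "(\<lambda>m. ln (a (\<sigma> (r m)) $ k)) \<longlonglongrightarrow> ln (a0 $ k)" if "k < t" for k
    using that conv[of "\<lambda>x. ln (a x $ k)"] by (simp add: a0_def F_def convergent_LIMSEQ_iff)
  have b_lim: "(\<lambda>m. b (\<sigma> (r m)) $ k) \<longlonglongrightarrow> b0 $ k" if "k < t" for k
    using that conv[of "\<lambda>x. b x $ k"] by (simp add: b0_def F_def convergent_LIMSEQ_iff)
  have a0: "a0 \<in> pos_vecs t" and b0: "b0 \<in> carrier_vec t"
    by (simp_all add: a0_def b0_def pos_vecs_def)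
  have a_lim: "(\<lambda>m. a (\<sigma> (r m)) $ k) \<longlonglongrightarrow> a0 $ k" if "k < t" for k
    using tendsto_exp[OF lna[OF that]] mem(4) a0 that by (simp add: pos_vecs_def)
  define x where "x = (S0, Q0, V0, a0, b0)"
  have xM: "x \<in> M_set n s t"
    using OB_closed[OF S0] Orth_closed[OF Q0] V_space_closed[OF V0] mem a0 b0
    by (simp add: x_def M_set_def n)
  have obj: "(\<lambda>m. objective s t \<Lambda> (\<sigma> (r m))) \<longlonglongrightarrow> objective s t \<Lambda> x"
    unfolding x_def
    by (subst \<sigma>_eq) (intro objective_tendsto[OF S0 Q0 V0 mem(4) a0 mem(5) b0 a_lim b_lim n])
  have "objective s t \<Lambda> x \<le> c"
    \<comment> \<open>All values along the sequence are at most \<open>c\<close>, and so is their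
      limit.\<close>
    using \<sigma> by (intro LIMSEQ_le_const2[OF obj]) (auto simp: lev_def)
  then have "x \<in> lev n s t \<Lambda> c" using xM by (simp add: lev_def)
  moreover have "(\<lambda>m. M_dist n t (\<sigma> (r m)) x) \<longlonglongrightarrow> 0"
  proof -
    have "(\<lambda>m. log_dist t (a (\<sigma> (r m))) a0) \<longlonglongrightarrow> 0"
      using tendsto_L2_set[of "{..<t}" "\<lambda>m k. ln (a (\<sigma> (r m)) $ k) - ln (a0 $ k)" "\<lambda>_. 0" sequentially]
        lna by (auto simp: log_dist_def L2_set_0' LIM_zero)
    moreover have "(\<lambda>m. vec_dist t (b (\<sigma> (r m))) b0) \<longlonglongrightarrow> 0"
      using tendsto_L2_set[of "{..<t}" "\<lambda>m k. b (\<sigma> (r m)) $ k - b0 $ k" "\<lambda>_. 0" sequentially]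
        b_lim by (auto simp: vec_dist_def L2_set_0' LIM_zero)
    ultimately have "(\<lambda>m. M_dist n t (S (\<sigma> (r m)), Q (\<sigma> (r m)), V (\<sigma> (r m)), a (\<sigma> (r m)), b (\<sigma> (r m)))
        (S0, Q0, V0, a0, b0)) \<longlonglongrightarrow> sqrt (0\<^sup>2 + 0\<^sup>2 + 0\<^sup>2 + 0\<^sup>2 + 0\<^sup>2)"
      unfolding M_dist.simps
      by (intro tendsto_real_sqrt tendsto_add tendsto_power mat_dist_tendsto_0 S0 Q0 V0)
    then show ?thesis by (simp add: x_def \<sigma>_eq[symmetric])
  qed
  then have "limitin (M_topology n s t) (\<sigma> \<circ> r) x sequentially"
    using xM \<sigma> by (simp add: Metric_space.limitin_metric_dist_null[OF Metric_space_M] lev_def)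
  ultimately show thesis using that r obj by blast
qed

lemma compactin_lev:
  assumes "spectrum_vec n s t \<Lambda>"
  shows "compactin (M_topology n s t) (lev n s t \<Lambda> c)"
  unfolding Metric_space.compactin_sequentially[OF Metric_space_M]
proof (intro conjI allI impI)
  show "lev n s t \<Lambda> c \<subseteq> M_set n s t" by (auto simp: lev_def)
  fix \<sigma> :: "nat \<Rightarrow> point" assume "range \<sigma> \<subseteq> lev n s t \<Lambda> c"
  then have "\<sigma> m \<in> lev n s t \<Lambda> c" for m by auto
  then obtain r x where "strict_mono r" "x \<in> lev n s t \<Lambda> c"
    "limitin (M_topology n s t) (\<sigma> \<circ> r) x sequentially"
    by (rule lev_sequence[OF assms])
  then show "\<exists>l r. l \<in> lev n s t \<Lambda> c \<and> strict_mono r \<and>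
      limitin (M_topology n s t) (\<sigma> \<circ> r) l sequentially"
    by blast
qed

section \<open>Existence and compactness of the set of minimizers\<close>

lemma M_set_nonempty:
  assumes "n = s + 2 * t"
  shows "M_set n s t \<noteq> {}"
proof -
  have "1\<^sub>m n \<in> Orth n" by (simp add: Orth_def)
  then have "(1\<^sub>m n, 1\<^sub>m n, 0\<^sub>m n n, vec t (\<lambda>_. 1), 0\<^sub>v t) \<in> M_set n s t"
    using Orth_subset_OB assms by (auto simp: M_set_def V_space_def pos_vecs_def)
  then show ?thesis by blast
qed

lemma objective_nonneg: "0 \<le> objective s t \<Lambda> x"
  by (cases x) simp

theorem proposition4p2:
  fixes n s t :: nat and \<Lambda> :: "complex vec"
  assumes "spectrum_vec n s t \<Lambda>"
  shows "(\<forall>c::real. M_bounded n s t (lev n s t \<Lambda> c)) \<and>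
    (\<forall>c::real. \<exists>\<delta>>0. \<forall>(S, Q, V, a, b) \<in> lev n s t \<Lambda> c. \<forall>k<t. \<delta> \<le> a $ k) \<and>
    (\<exists>x \<in> M_set n s t. objective s t \<Lambda> x = (INF y \<in> M_set n s t. objective s t \<Lambda> y)) \<and>
    compactin (M_topology n s t) (minimizers n s t \<Lambda>)"
proof (intro conjI allI)
  fix c :: real
  show "M_bounded n s t (lev n s t \<Lambda> c)"
    \<comment> \<open>Compact sets in a metric space are bounded.\<close>
    by (rule Metric_space.compactin_imp_mbounded[OF Metric_space_M compactin_lev[OF assms]])
  obtain B where B: "\<And>S Q V a b k. (S, Q, V, a, b) \<in> lev n s t \<Lambda> c \<Longrightarrow> k < t \<Longrightarrow>
      \<bar>ln (a $ k)\<bar> \<le> B \<and> \<bar>b $ k\<bar> \<le> B"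
    by (rule lev_bounds[OF assms]) blast
  \<comment> \<open>The lower half of the bound on \<open>ln (a $ k)\<close>, exponentiated, gives
    the witness \<open>exp (- B)\<close>.\<close>
  have "exp (- B) \<le> a $ k" if "(S, Q, V, a, b) \<in> lev n s t \<Lambda> c" "k < t"
    for S Q V :: "real mat" and a b :: "real vec" and k
  proof -
    have "0 < a $ k" using that by (auto simp: lev_def M_set_def pos_vecs_def)
    moreover have "- B \<le> ln (a $ k)" using B[OF that] by linarith
    ultimately show ?thesis by (simp add: ln_ge_iff)
  qed
  then have "\<forall>(S, Q, V, a, b) \<in> lev n s t \<Lambda> c. \<forall>k<t. exp (- B) \<le> a $ k" by blast
  then show "\<exists>\<delta>>0. \<forall>(S, Q, V, a, b) \<in> lev n s t \<Lambda> c. \<forall>k<t. \<delta> \<le> a $ k"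
    using exp_gt_zero by blast
next
  have n: "n = s + 2 * t" using assms by (simp add: spectrum_vec_def)
  let ?f = "objective s t \<Lambda>" and ?M = "M_set n s t"
  define m where "m = (INF y \<in> ?M. ?f y)"
  have bdd: "bdd_below (?f ` ?M)" by (rule bdd_belowI[of _ 0]) (auto simp: objective_nonneg)
  have m_le: "m \<le> ?f y" if "y \<in> ?M" for y
    unfolding m_def using bdd that by (rule cINF_lower)
  \<comment> \<open>A minimizing sequence; the infimum is a genuine one, as the objective is
    nonnegative and the parameter set nonempty.\<close>
  have "\<exists>y\<in>?M. ?f y < m + 1 / real (Suc k)" for k
    using cINF_less_iff[OF M_set_nonempty[OF n] bdd, of "m + 1 / real (Suc k)"]
    by (simp add: m_def)
  then obtain \<sigma> where \<sigma>: "\<And>k. \<sigma> k \<in> ?M" "\<And>k. ?f (\<sigma> k) < m + 1 / real (Suc k)"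
    by metis
  \<comment> \<open>The excess over \<open>m\<close> is below 1 throughout, or at most 1 for
    \<open>k = 0\<close>, so a single level set holds the whole sequence.\<close>
  have "\<sigma> k \<in> lev n s t \<Lambda> (m + 1)" for k
  proof -
    have "1 / real (Suc k) \<le> 1" by simp
    then have "?f (\<sigma> k) \<le> m + 1" using \<sigma>(2)[of k] by linarith
    then show ?thesis using \<sigma>(1)[of k] by (simp add: lev_def)
  qed
  then obtain r x where r: "strict_mono r" and x: "x \<in> lev n s t \<Lambda> (m + 1)"
    and lim: "(\<lambda>k. ?f (\<sigma> (r k))) \<longlonglongrightarrow> ?f x"
    by (rule lev_sequence[OF assms])
  have "(\<lambda>k. m + 1 / real (Suc k)) \<longlonglongrightarrow> m + 0"
    by (intro tendsto_add tendsto_const lim_1_over_n[THEN LIMSEQ_Suc])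
  then have "(\<lambda>k. m + 1 / real (Suc k)) \<longlonglongrightarrow> m" by (simp only: add_0_right)
  then have "(\<lambda>k. ?f (\<sigma> k)) \<longlonglongrightarrow> m"
    by (rule tendsto_sandwich[OF _ _ tendsto_const, rotated 2])
      (intro always_eventually allI m_le \<sigma>(1) less_imp_le[OF \<sigma>(2)])+
  \<comment> \<open>Along the subsequence the values tend both to \<open>?f x\<close> and to
    \<open>m\<close>.\<close>
  then have fx: "?f x = m"
    using LIMSEQ_unique[OF lim] LIMSEQ_subseq_LIMSEQ[OF _ r, of "\<lambda>k. ?f (\<sigma> k)"]
    by (simp add: o_def)
  then show "\<exists>x \<in> ?M. ?f x = (INF y \<in> ?M. ?f y)"
    using x by (auto simp: lev_def m_def)
  \<comment> \<open>At the attained minimal value the level set consists exactly of the minimizers,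
    so its compactness carries over.\<close>
  have "minimizers n s t \<Lambda> = lev n s t \<Lambda> m"
    using fx x m_le by (force simp: minimizers_def lev_def)
  then show "compactin (M_topology n s t) (minimizers n s t \<Lambda>)"
    using compactin_lev[OF assms] by simp
qed

end
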